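(* Let $F=\frac1n\sum_{i=1}^n F_i:\mathbb{R}^d\to\mathbb{R}^d$ be $L$-Lipschitz and satisfy the Weak Minty condition with parameter $\rho<\frac1{2L}$ with respect to a point $x_*$ with $F(x_* )=0$. Let the Expected Residual condition hold with parameter $\delta>0$. Assume $\gamma_k=\gamma$, $\omega_k=\omega$ for all $k$, with $$\max\left\{2\rho,\frac1{2L}\right\}<\gamma<\frac1L,\qquad 0<\omega<\min\left\{\gamma-2\rho,\ \frac1{4L}-\frac\gamma4\right\}.$$ Then for all $K\ge2$ the iterates produced by mini-batched SPEG with batch-size $$\tau\ge\max\left\{1,\ \frac{32\delta}{(1-L\gamma)L^3\omega},\ \frac{48\omega\gamma\delta(K-1)}{(1-L\gamma)^2},\ \frac{2\omega\gamma\sigma_*^2(K-1)}{(1-L\gamma)\|x_0-x_*\|^2}\right\}$$ satisfy $$\min_{0\le k\le K-1}\mathbb{E}\left[\|F(\hat x_k)\|^2\right]\le\frac{C\|x_0-x_*\|^2}{K-1},\qquad C=\frac{48}{\omega\gamma\left(1-L(\gamma+4\omega)\right)}.$$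
   Context: Stochastic estimator: $v\in\mathbb{R}^n_+$ is a random sampling vector with distribution $\mathcal D$ satisfying $\mathbb{E}_{\mathcal D}[v_i]=1$ for all $i$, and $F_v(x):=\frac1n\sum_{i=1}^n v_iF_i(x)$, so $\mathbb{E}_{\mathcal D}[F_v(x)]=F(x)$. SPEG (Stochastic Past Extragradient): $\hat x_{-1}=x_0$, the $v_k\sim\mathcal D$ are sampled i.i.d. at each iteration, and for $k\ge0$ $$\hat x_k=x_k-\gamma_kF_{v_{k-1}}(\hat x_{k-1}),\qquad x_{k+1}=x_k-\omega_kF_{v_k}(\hat x_k).$$ Mini-batched SPEG with (integer) batch-size $\tau$ is the same method in which at each iteration the estimator $F_{v_k}(\hat x_k)$ is replaced by $\frac1\tau\sum_{j=1}^\tau F_{v_{k,j}}(\hat x_k)$ with $v_{k,1},\dots,v_{k,\tau}$ independent samples from $\mathcal D$ (this same averaged vector is reused in the next extrapolation step). Weak Minty condition with parameter $\rho\ge0$: $\langle F(x),x-x_*\rangle\ge-\rho\|F(x)\|^2$ for all $x\in\mathbb{R}^d$. Expected Residual (ER) condition with parameter $\delta>0$ (for a single sample $v\sim\mathcal D$): for all $x$, $\mathbb{E}\left[\|(F_v(x)-F_v(x_* ))-(F(x)-F(x_* ))\|^2\right]\le\frac\delta2\|x-x_*\|^2$. $\sigma_*^2:=\mathbb{E}\|F_v(x_* )\|^2<\infty$ (single sample). *)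

theory Defs
  imports "HOL-Probability.Probability"
begin

definition avg_op :: "('n::finite \<Rightarrow> real^'d \<Rightarrow> real^'d) \<Rightarrow> real^'d \<Rightarrow> real^'d" where
  "avg_op Fs x = (1 / real CARD('n)) *\<^sub>R (\<Sum>i\<in>UNIV. Fs i x)"

definition stoch_op ::
  "('n::finite \<Rightarrow> real^'d \<Rightarrow> real^'d) \<Rightarrow> real^'n \<Rightarrow> real^'d \<Rightarrow> real^'d" where
  "stoch_op Fs v x = (1 / real CARD('n)) *\<^sub>R (\<Sum>i\<in>UNIV. (v $ i) *\<^sub>R Fs i x)"

definition minibatch_op ::
  "('n::finite \<Rightarrow> real^'d \<Rightarrow> real^'d) \<Rightarrow> nat \<Rightarrow> (nat \<Rightarrow> real^'n) \<Rightarrow> real^'d \<Rightarrow> real^'d" where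
  "minibatch_op Fs \<tau> u x = (1 / real \<tau>) *\<^sub>R (\<Sum>j=1..\<tau>. stoch_op Fs (u j) x)"

text \<open>A non-integrable function has Bochner integral \<open>0\<close>, so the mean-one condition
  forces every coordinate to be integrable.\<close>

definition sampling_distribution :: "(real^'n) measure \<Rightarrow> bool" where
  "sampling_distribution D \<longleftrightarrow>
     prob_space D \<and> sets D = sets borel \<and>
     (AE v in D. \<forall>i. 0 \<le> v $ i) \<and>
     (\<forall>i. (\<integral>v. v $ i \<partial>D) = 1)"

definition weak_minty :: "(real^'d \<Rightarrow> real^'d) \<Rightarrow> real \<Rightarrow> real^'d \<Rightarrow> bool" where
  "weak_minty F \<rho> xs \<longleftrightarrow> (\<forall>x. F x \<bullet> (x - xs) \<ge> - \<rho> * (norm (F x))\<^sup>2)"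

text \<open>Integrability is required explicitly, because a divergent expectation would
  otherwise count as \<open>0\<close> and satisfy the bound.\<close>

definition expected_residual ::
  "(real^'n) measure \<Rightarrow> ('n::finite \<Rightarrow> real^'d \<Rightarrow> real^'d) \<Rightarrow> real \<Rightarrow> real^'d \<Rightarrow> bool" where
  "expected_residual D Fs \<delta> xs \<longleftrightarrow>
     (\<forall>x. let r = (\<lambda>v. (norm ((stoch_op Fs v x - stoch_op Fs v xs)
                             - (avg_op Fs x - avg_op Fs xs)))\<^sup>2)
          in integrable D r \<and> (\<integral>v. r v \<partial>D) \<le> \<delta> / 2 * (norm (x - xs))\<^sup>2)"

definition sigma_sq ::
  "(real^'n) measure \<Rightarrow> ('n::finite \<Rightarrow> real^'d \<Rightarrow> real^'d) \<Rightarrow> real^'d \<Rightarrow> real" where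
  "sigma_sq D Fs xs = (\<integral>v. (norm (stoch_op Fs v xs))\<^sup>2 \<partial>D)"

text \<open>Iterations are indexed by \<open>int\<close> because the method uses a sample and a point with
  index \<open>-1\<close>. The vector \<open>v k j\<close> is the \<open>j\<close>-th sample (\<open>1 \<le> j \<le> \<tau>\<close>) of iteration \<open>k \<ge> -1\<close>;
  all these vectors are jointly independent with law \<open>D\<close>.\<close>

definition iid_samples ::
  "'w measure \<Rightarrow> (real^'n) measure \<Rightarrow> nat \<Rightarrow> (int \<Rightarrow> nat \<Rightarrow> 'w \<Rightarrow> real^'n) \<Rightarrow> bool" where
  "iid_samples M D \<tau> v \<longleftrightarrow>
     prob_space.indep_vars M (\<lambda>_. borel) (\<lambda>(k, j). v k j) ({-1..} \<times> {1..\<tau>}) \<and>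
     (\<forall>k\<ge>-1. \<forall>j\<in>{1..\<tau>}. distr M borel (v k j) = D)"

text \<open>Values of \<open>x\<close> at indices below \<open>0\<close> and of \<open>xh\<close> below \<open>-1\<close> are irrelevant.
  The mini-batch drawn at iteration \<open>k\<close> enters both the update to \<open>x (k + 1)\<close> and the
  extrapolation to \<open>xh (k + 1)\<close>.\<close>

definition minibatch_SPEG ::
  "'w measure \<Rightarrow> ('n::finite \<Rightarrow> real^'d \<Rightarrow> real^'d) \<Rightarrow> nat \<Rightarrow> (int \<Rightarrow> real) \<Rightarrow> (int \<Rightarrow> real) \<Rightarrow>
   real^'d \<Rightarrow> (int \<Rightarrow> nat \<Rightarrow> 'w \<Rightarrow> real^'n) \<Rightarrow> (int \<Rightarrow> 'w \<Rightarrow> real^'d) \<Rightarrow> (int \<Rightarrow> 'w \<Rightarrow> real^'d) \<Rightarrow> bool"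
where
  "minibatch_SPEG M Fs \<tau> \<gamma> \<omega> x0 v x xh \<longleftrightarrow>
     (\<forall>w\<in>space M.
        x 0 w = x0 \<and> xh (-1) w = x0 \<and>
        (\<forall>k\<ge>0.
           xh k w = x k w - \<gamma> k *\<^sub>R minibatch_op Fs \<tau> (\<lambda>j. v (k - 1) j w) (xh (k - 1) w) \<and>
           x (k + 1) w = x k w - \<omega> k *\<^sub>R minibatch_op Fs \<tau> (\<lambda>j. v k j w) (xh k w)))"

end

theory Submission
  imports Defs
begin

text \<open>
  Each step of the method should decrease the expected squared distance \<open>D\<close> to \<open>xs\<close>. The
  weak Minty condition and polarization give, with \<open>t = \<omega> * \<gamma>\<close>, a decrease of \<open>t\<close> times the energy
  \<open>G\<close> of the past estimate, at the price of \<open>t\<close> times the squared error \<open>e\<close> of using the past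
  estimate in place of the current operator value, and of the variance. Because \<open>L * \<gamma> < 1\<close>,
  the error obeys a damped recursion with factor \<open>1 - a\<close>, \<open>a = 1 - L * \<gamma>\<close>, driven by
  \<open>a / 8\<close> times the energy (this uses \<open>4 * (L * \<omega>) < a\<close>) and by the variance. Summed over the
  iterations, this share of the errors is an eighth of the total energy and is absorbed by it. This
  is \<open>past_extragradient_energy_bound\<close>, and the resulting inequality for real sequences is
  \<open>damped_descent_sum_bound\<close>.

  The variance is not bounded uniformly. For batches of size \<open>\<tau>\<close> it is at most \<open>\<delta> / \<tau>\<close> times the
  squared distance of the extrapolated point to \<open>xs\<close>, plus \<open>2 / \<tau>\<close> times the second moment at \<open>xs\<close>
  (\<open>minibatch_op_noise\<close>). That distance is bounded by \<open>D\<close> and \<open>\<gamma>\<^sup>2 * G\<close>. The three nontrivial lower bounds on \<open>\<tau>\<close>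
  handle the three resulting contributions: the one of \<open>\<gamma>\<^sup>2 * G\<close> is absorbed by the energy in every
  step, the one of \<open>D\<close> is small when summed over \<open>K - 1\<close> steps, so that an induction keeps \<open>D\<close> of
  order \<open>(norm (x0 - xs))\<^sup>2 / a\<close>, and the constant one sums to that order as well.

  The probabilistic input is that the points of an iteration are functions of earlier batches, while
  the current batch is independent of those. Fubini on the joint law then makes the noise centred
  and orthogonal to the past (\<open>minibatch_estimator\<close>).
\<close>

section \<open>Square integrable random vectors\<close>

definition square_integrable :: "'a measure \<Rightarrow> ('a \<Rightarrow> 'b::euclidean_space) \<Rightarrow> bool" where
  "square_integrable M f \<longleftrightarrow> f \<in> borel_measurable M \<and> integrable M (\<lambda>w. (norm (f w))\<^sup>2)"

lemma square_integrableD: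
  assumes "square_integrable M f"
  shows "f \<in> borel_measurable M" "integrable M (\<lambda>w. (norm (f w))\<^sup>2)"
  using assms by (auto simp: square_integrable_def)

lemma norm_add_square_le: "(norm (x + y))\<^sup>2 \<le> 2 * (norm x)\<^sup>2 + 2 * (norm (y::'a::real_inner))\<^sup>2"
proof -
  have "0 \<le> (norm (x - y))\<^sup>2" by simp
  then show ?thesis by (simp add: power2_norm_eq_inner inner_simps inner_commute)
qed

lemma square_integrable_add:
  assumes "square_integrable M f" "square_integrable M g"
  shows "square_integrable M (\<lambda>w. f w + g w)"
  unfolding square_integrable_def
proof
  note [measurable] = square_integrableD(1)[OF assms(1)] square_integrableD(1)[OF assms(2)]
  show "(\<lambda>w. f w + g w) \<in> borel_measurable M" by measurable
  show "integrable M (\<lambda>w. (norm (f w + g w))\<^sup>2)"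
  proof (rule Bochner_Integration.integrable_bound)
    show "integrable M (\<lambda>w. 2 * (norm (f w))\<^sup>2 + 2 * (norm (g w))\<^sup>2)"
      using assms by (simp add: square_integrable_def)
    show "AE w in M. norm ((norm (f w + g w))\<^sup>2) \<le> norm (2 * (norm (f w))\<^sup>2 + 2 * (norm (g w))\<^sup>2)"
      using norm_add_square_le by auto
  qed measurable
qed

lemma square_integrable_scaleR:
  assumes "square_integrable M f"
  shows "square_integrable M (\<lambda>w. c *\<^sub>R f w)"
  using assms by (auto simp: square_integrable_def power_mult_distrib)

lemma square_integrable_diff:
  assumes "square_integrable M f" "square_integrable M g"
  shows "square_integrable M (\<lambda>w. f w - g w)"
  using square_integrable_add[OF assms(1) square_integrable_scaleR[OF assms(2), of "-1"]] by simp

lemma (in finite_measure) square_integrable_const: "square_integrable M (\<lambda>_. c)"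
  by (auto simp: square_integrable_def)

lemma square_integrable_inner:
  assumes "square_integrable M f" "square_integrable M g"
  shows "integrable M (\<lambda>w. f w \<bullet> g w)"
proof -
  have "integrable M (\<lambda>w. ((norm (f w + g w))\<^sup>2 - (norm (f w))\<^sup>2 - (norm (g w))\<^sup>2) / 2)"
    using assms square_integrable_add[OF assms] by (simp add: square_integrable_def)
  also have "(\<lambda>w. ((norm (f w + g w))\<^sup>2 - (norm (f w))\<^sup>2 - (norm (g w))\<^sup>2) / 2) = (\<lambda>w. f w \<bullet> g w)"
    by (simp add: fun_eq_iff power2_norm_eq_inner inner_simps inner_commute)
  finally show ?thesis .
qed

lemma (in finite_measure) square_integrable_imp_integrable:
  assumes "square_integrable M f"
  shows "integrable M f"
proof (rule Bochner_Integration.integrable_bound)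
  show "integrable M (\<lambda>w. 1 + (norm (f w))\<^sup>2)"
    using assms by (simp add: square_integrable_def)
  have "z \<le> 1 + z\<^sup>2" for z :: real
    using zero_le_power2[of "z - 1/2"] by (simp add: power2_diff power_divide)
  then show "AE w in M. norm (f w) \<le> norm (1 + (norm (f w))\<^sup>2)" by auto
qed (rule square_integrableD[OF assms])

lemma square_integrable_Lipschitz:
  assumes "finite_measure M" "square_integrable M f" "L-lipschitz_on UNIV F"
  shows "square_integrable M (\<lambda>w. F (f w))"
proof -
  interpret finite_measure M by fact
  have [measurable]: "F \<in> borel_measurable borel"
    by (rule borel_measurable_continuous_onI) (rule lipschitz_on_continuous_on[OF assms(3)])
  note [measurable] = square_integrableD(1)[OF assms(2)]
  have L: "0 \<le> L" using assms(3) by (rule lipschitz_on_nonneg)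
  have "square_integrable M (\<lambda>w. F (f w) - F 0)"
    unfolding square_integrable_def
  proof
    show "integrable M (\<lambda>w. (norm (F (f w) - F 0))\<^sup>2)"
    proof (rule Bochner_Integration.integrable_bound)
      show "integrable M (\<lambda>w. L\<^sup>2 * (norm (f w))\<^sup>2)"
        using assms by (simp add: square_integrable_def)
      have "(norm (F u - F 0))\<^sup>2 \<le> (L * norm u)\<^sup>2" for u
        using lipschitz_onD[OF assms(3), of u 0] L by (intro power_mono) (auto simp: dist_norm)
      then show "AE w in M. norm ((norm (F (f w) - F 0))\<^sup>2) \<le> norm (L\<^sup>2 * (norm (f w))\<^sup>2)"
        by (auto simp: power_mult_distrib)
    qed measurable
  qed measurable
  from square_integrable_add[OF this square_integrable_const[of "F 0"]] show ?thesis by simp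
qed

lemma square_integrable_distr:
  assumes "T \<in> measurable M N" "f \<in> borel_measurable N"
  shows "square_integrable (distr M N T) f \<longleftrightarrow> square_integrable M (\<lambda>w. f (T w))"
proof -
  have [measurable]: "T \<in> measurable M N" "f \<in> borel_measurable N" by fact+
  show ?thesis
    unfolding square_integrable_def by (subst integrable_distr_eq) (auto intro: assms)
qed

section \<open>Sums of independent centred samples, and integration against a fresh sample\<close>

text \<open>Expanding the square, the cross terms between distinct samples vanish because each sample is
  centred, so only the diagonal survives. The induction adds one sample at a time and integrates it
  out first.\<close>
lemma iid_centred_sum_second_moment:
  fixes f :: "'a \<Rightarrow> 'b::euclidean_space"
  assumes "prob_space D" and f: "square_integrable D f" and mean: "(\<integral>z. f z \<partial>D) = 0"
    and "finite I"
  shows "square_integrable (PiM I (\<lambda>_. D)) (\<lambda>z. \<Sum>i\<in>I. f (z i)) \<and>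
    (\<integral>z. (norm (\<Sum>i\<in>I. f (z i)))\<^sup>2 \<partial>PiM I (\<lambda>_. D)) = real (card I) * (\<integral>z. (norm (f z))\<^sup>2 \<partial>D)"
  using \<open>finite I\<close>
proof induction
  interpret D: prob_space D by fact
  case empty
  interpret prob_space "PiM {} (\<lambda>_. D)" by (intro prob_space_PiM D.prob_space_axioms)
  show ?case by (simp add: square_integrable_const)
next
  interpret D: prob_space D by fact
  interpret product_sigma_finite "\<lambda>_. D" by standard
  note [measurable] = square_integrableD(1)[OF f]
  note f2 = square_integrableD(2)[OF f] and f1 = D.square_integrable_imp_integrable[OF f]
  case (insert i I)
  have comp: "square_integrable (PiM (insert i I) (\<lambda>_. D)) (\<lambda>z. f (z j))" if "j \<in> insert i I" for j
    using f distr_PiM_component[of "insert i I" "\<lambda>_. D" j] D.prob_space_axioms that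
      square_integrable_distr[of "\<lambda>z. z j" "PiM (insert i I) (\<lambda>_. D)" D f]
    by (simp add: measurable_component_singleton square_integrableD)
  have "square_integrable (PiM (insert i I) (\<lambda>_. D)) (\<lambda>z. \<Sum>j\<in>J. f (z j))"
    if "finite J" "J \<subseteq> insert i I" for J
    using that
  proof induction
    case empty
    interpret prob_space "PiM (insert i I) (\<lambda>_. D)" by (intro prob_space_PiM D.prob_space_axioms)
    show ?case by (simp add: square_integrable_const)
  next
    case (insert j J)
    then show ?case using comp by (auto intro: square_integrable_add)
  qed
  then have sq: "square_integrable (PiM (insert i I) (\<lambda>_. D)) (\<lambda>z. \<Sum>j\<in>insert i I. f (z j))"
    using insert by blast
  interpret P: prob_space "PiM I (\<lambda>_. D)" by (intro prob_space_PiM D.prob_space_axioms)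
  have "(\<integral>z. (norm (\<Sum>j\<in>insert i I. f (z j)))\<^sup>2 \<partial>PiM (insert i I) (\<lambda>_. D))
    = (\<integral>z. \<integral>y. (norm (\<Sum>j\<in>insert i I. f ((z(i := y)) j)))\<^sup>2 \<partial>D \<partial>PiM I (\<lambda>_. D))"
    by (rule product_integral_insert[OF insert(1,2) square_integrableD(2)[OF sq]])
  also have "\<dots> = (\<integral>z. (norm (\<Sum>j\<in>I. f (z j)))\<^sup>2 + (\<integral>y. (norm (f y))\<^sup>2 \<partial>D) \<partial>PiM I (\<lambda>_. D))"
  proof (rule Bochner_Integration.integral_cong[OF refl])
    fix z
    define S where "S = (\<Sum>j\<in>I. f (z j))"
    have "(\<Sum>j\<in>insert i I. f ((z(i := y)) j)) = f y + S" for y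
      using insert(1,2) by (auto simp: S_def intro!: sum.cong)
    then have "(\<integral>y. (norm (\<Sum>j\<in>insert i I. f ((z(i := y)) j)))\<^sup>2 \<partial>D)
      = (\<integral>y. (norm S)\<^sup>2 + (norm (f y))\<^sup>2 + 2 * (S \<bullet> f y) \<partial>D)"
      by (simp add: power2_norm_eq_inner inner_simps inner_commute algebra_simps)
    also have "\<dots> = (norm S)\<^sup>2 + (\<integral>y. (norm (f y))\<^sup>2 \<partial>D) + 2 * (S \<bullet> (\<integral>y. f y \<partial>D))"
      using f1 f2 by (simp add: D.prob_space)
    finally show "(\<integral>y. (norm (\<Sum>j\<in>insert i I. f ((z(i := y)) j)))\<^sup>2 \<partial>D)
      = (norm (\<Sum>j\<in>I. f (z j)))\<^sup>2 + (\<integral>y. (norm (f y))\<^sup>2 \<partial>D)"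
      by (simp add: mean S_def)
  qed
  also have "\<dots> = real (card (insert i I)) * (\<integral>z. (norm (f z))\<^sup>2 \<partial>D)"
    using insert by (simp add: square_integrable_def P.prob_space algebra_simps)
  finally show ?case using sq by simp
qed

text \<open>Fubini for an independent pair whose components have different types. \<open>indep_var\<close> forces both
  components into one type, so independence is expressed here by the joint law being the product
  of the marginals; this replaces conditioning on \<open>Y\<close>.\<close>
lemma (in prob_space) integral_indep_pair:
  fixes h :: "_ \<Rightarrow> _ \<Rightarrow> real"
  assumes rv[measurable]: "random_variable S Y" "random_variable T Z"
    and eq: "distr M S Y \<Otimes>\<^sub>M distr M T Z = distr M (S \<Otimes>\<^sub>M T) (\<lambda>w. (Y w, Z w))"
    and h[measurable]: "case_prod h \<in> borel_measurable (S \<Otimes>\<^sub>M T)"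
    and int: "integrable M (\<lambda>w. h (Y w) (Z w))"
  shows "expectation (\<lambda>w. h (Y w) (Z w)) = (\<integral>y. \<integral>z. h y z \<partial>distr M T Z \<partial>distr M S Y)"
proof -
  interpret Y: prob_space "distr M S Y" by (rule prob_space_distr) fact
  interpret Z: prob_space "distr M T Z" by (rule prob_space_distr) fact
  interpret pair_prob_space "distr M S Y" "distr M T Z" ..
  have "integrable (distr M S Y \<Otimes>\<^sub>M distr M T Z) (case_prod h)"
    unfolding eq using int by (subst integrable_distr_eq) auto
  from integral_fst[OF this] show ?thesis
    unfolding eq by (simp add: integral_distr)
qed

text \<open>The conditional form of a variance bound: if for each fixed \<open>y\<close> the second moment over \<open>Z\<close> is at
  most \<open>b y\<close>, then it is at most the mean of \<open>b Y\<close>. Square integrability is a conclusion, obtained from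
  Tonelli; this is what makes the iterates square integrable one after the other.\<close>
lemma (in prob_space) second_moment_indep_pair:
  fixes h :: "_ \<Rightarrow> _ \<Rightarrow> 'b::euclidean_space"
  assumes rv[measurable]: "random_variable S Y" "random_variable T Z"
    and eq: "distr M S Y \<Otimes>\<^sub>M distr M T Z = distr M (S \<Otimes>\<^sub>M T) (\<lambda>w. (Y w, Z w))"
    and h[measurable]: "case_prod h \<in> borel_measurable (S \<Otimes>\<^sub>M T)"
    and h2: "\<And>y. y \<in> space S \<Longrightarrow> integrable (distr M T Z) (\<lambda>z. (norm (h y z))\<^sup>2)"
    and bound: "\<And>y. y \<in> space S \<Longrightarrow> (\<integral>z. (norm (h y z))\<^sup>2 \<partial>distr M T Z) \<le> b y"
    and b[measurable]: "b \<in> borel_measurable S" and bint: "integrable M (\<lambda>w. b (Y w))"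
  shows "square_integrable M (\<lambda>w. h (Y w) (Z w))"
    and "expectation (\<lambda>w. (norm (h (Y w) (Z w)))\<^sup>2) \<le> expectation (\<lambda>w. b (Y w))"
proof -
  interpret Y: prob_space "distr M S Y" by (rule prob_space_distr) fact
  interpret Z: prob_space "distr M T Z" by (rule prob_space_distr) fact
  have [measurable]: "(\<lambda>w. h (Y w) (Z w)) \<in> borel_measurable M"
    using measurable_compose[OF measurable_Pair[OF rv] h] by simp
  have b0: "0 \<le> b y" if "y \<in> space S" for y
    using bound[OF that] by (rule order_trans[rotated]) simp
  have "(\<integral>\<^sup>+w. ennreal ((norm (h (Y w) (Z w)))\<^sup>2) \<partial>M)
    = (\<integral>\<^sup>+p. ennreal ((norm (case_prod h p))\<^sup>2) \<partial>(distr M S Y \<Otimes>\<^sub>M distr M T Z))"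
    unfolding eq by (subst nn_integral_distr) auto
  also have "\<dots> = (\<integral>\<^sup>+y. \<integral>\<^sup>+z. ennreal ((norm (h y z))\<^sup>2) \<partial>distr M T Z \<partial>distr M S Y)"
    by (subst Z.nn_integral_fst[symmetric]) auto
  also have "\<dots> \<le> (\<integral>\<^sup>+y. ennreal (b y) \<partial>distr M S Y)"
  proof (rule nn_integral_mono)
    fix y assume "y \<in> space (distr M S Y)"
    then have y: "y \<in> space S" by simp
    then show "(\<integral>\<^sup>+z. ennreal ((norm (h y z))\<^sup>2) \<partial>distr M T Z) \<le> ennreal (b y)"
      using bound[OF y] by (subst nn_integral_eq_integral[OF h2[OF y]]) (auto intro: ennreal_leI)
  qed
  also have "\<dots> = (\<integral>\<^sup>+w. ennreal (b (Y w)) \<partial>M)" by (rule nn_integral_distr) auto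
  also have "\<dots> = ennreal (expectation (\<lambda>w. b (Y w)))"
    using b0 measurable_space[OF rv(1)] by (intro nn_integral_eq_integral[OF bint]) auto
  finally have le: "(\<integral>\<^sup>+w. ennreal ((norm (h (Y w) (Z w)))\<^sup>2) \<partial>M) \<le> ennreal (expectation (\<lambda>w. b (Y w)))" .
  then have int: "integrable M (\<lambda>w. (norm (h (Y w) (Z w)))\<^sup>2)"
    by (intro integrableI_nonneg) (auto simp: le_less_trans)
  then show "square_integrable M (\<lambda>w. h (Y w) (Z w))" by (simp add: square_integrable_def)
  have "0 \<le> expectation (\<lambda>w. b (Y w))"
    using b0 measurable_space[OF rv(1)] by (intro integral_nonneg_AE) auto
  then show "expectation (\<lambda>w. (norm (h (Y w) (Z w)))\<^sup>2) \<le> expectation (\<lambda>w. b (Y w))"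
    using le by (subst (asm) nn_integral_eq_integral[OF int]) auto
qed

text \<open>Whatever is computed from \<open>P\<close> alone is independent of whatever is computed from \<open>Q\<close> alone. Here
  \<open>P\<close> will collect the samples of all earlier iterations and \<open>Q\<close> those of the current one.\<close>
lemma (in prob_space) distr_Pair_indep_var:
  assumes indep: "indep_var N P N' Q"
    and Y: "Y \<in> measurable (vimage_algebra (space M) P N) S"
    and Z: "Z \<in> measurable (vimage_algebra (space M) Q N') T"
  shows "random_variable S Y" "random_variable T Z"
    and "distr M S Y \<Otimes>\<^sub>M distr M T Z = distr M (S \<Otimes>\<^sub>M T) (\<lambda>w. (Y w, Z w))"
proof -
  have P: "random_variable N P" and Q: "random_variable N' Q"
    and set: "indep_set (sets (vimage_algebra (space M) P N)) (sets (vimage_algebra (space M) Q N'))"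
    using indep unfolding indep_var_eq by (auto simp: sets_vimage_algebra)
  then have sub: "sets (vimage_algebra (space M) P N) \<subseteq> events" "sets (vimage_algebra (space M) Q N') \<subseteq> events"
    unfolding indep_sets2_eq by auto
  show rv[measurable]: "random_variable S Y" "random_variable T Z"
    using Y Z sub by (auto simp: measurable_def)
  interpret Y: prob_space "distr M S Y" by (rule prob_space_distr) fact
  interpret Z: prob_space "distr M T Z" by (rule prob_space_distr) fact
  show "distr M S Y \<Otimes>\<^sub>M distr M T Z = distr M (S \<Otimes>\<^sub>M T) (\<lambda>w. (Y w, Z w))"
  proof (rule pair_measure_eqI)
    fix A B assume "A \<in> sets (distr M S Y)" "B \<in> sets (distr M T Z)"
    then have [measurable]: "A \<in> sets S" "B \<in> sets T" by auto
    have "prob ((Y -` A \<inter> space M) \<inter> (Z -` B \<inter> space M)) = prob (Y -` A \<inter> space M) * prob (Z -` B \<inter> space M)"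
      using measurable_sets[OF Y \<open>A \<in> sets S\<close>] measurable_sets[OF Z \<open>B \<in> sets T\<close>]
      by (intro indep_setD[OF set]) auto
    moreover have "(\<lambda>w. (Y w, Z w)) -` (A \<times> B) \<inter> space M = (Y -` A \<inter> space M) \<inter> (Z -` B \<inter> space M)"
      by auto
    ultimately show "emeasure (distr M S Y) A * emeasure (distr M T Z) B
        = emeasure (distr M (S \<Otimes>\<^sub>M T) (\<lambda>w. (Y w, Z w))) (A \<times> B)"
      by (simp add: emeasure_distr emeasure_eq_measure ennreal_mult)
  qed (auto intro: Y.sigma_finite_measure_axioms Z.sigma_finite_measure_axioms sets_pair_measure_cong)
qed

section \<open>A damped descent inequality for real sequences\<close>

text \<open>In the application \<open>D\<close> is the squared distance to the solution, \<open>G\<close> the energy of the estimator,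
  \<open>e\<close> the error made by extrapolating with a past estimate, and \<open>V\<close> the variance, which itself
  grows with \<open>D\<close> and \<open>G\<close>. The error is damped by the factor \<open>1 - a\<close>, so with weight \<open>t / a\<close> one step
  of damping pays for the term \<open>t * e n\<close> in the descent. Hence \<open>D n + (t / a) * e n - (t / 8) * G n\<close>
  decreases up to variance; its negative term cancels the energy that the error recursion charges
  for the newest estimate, and is paid back by the descent of the next step.

  The variance is fed back through \<open>D\<close>. A strong induction up to the horizon \<open>m\<close> keeps
  \<open>D\<close> below \<open>16 * R / a\<close>: the constant part contributes about \<open>10.3 * R / a\<close>, and the hypothesis
  \<open>t * d * real m \<le> a\<^sup>2 / 48\<close> makes the feedback contribute about a third of the bound itself.\<close>
lemma damped_descent_sum_bound:
  fixes D e G V :: "nat \<Rightarrow> real" and a t q d c s R :: real and m :: nat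
  assumes a: "0 < a" "a \<le> 1/2" and t: "0 < t" and q: "0 \<le> q" "q \<le> t * a / 2"
    and pos: "0 \<le> d" "0 \<le> c" "0 \<le> s" "0 \<le> R"
    and nonneg: "\<And>n. 0 \<le> D n" "\<And>n. 0 \<le> e n" "\<And>n. 0 \<le> G n"
    and descent: "\<And>n. D (Suc n) \<le> D n - t * G n + t * e n + q * V (Suc n)"
    and err: "\<And>n. e (Suc n) \<le> (1 - a) * e n + a / 8 * G (Suc n) + 8 / a * V (Suc n)"
    and var: "\<And>n. V (Suc n) \<le> 2 * d * D n + 2 * d * c * G n + s"
    and D0: "D 0 = R"
    and e0: "t / a * e 0 \<le> R / 4 + 3 / 2 * (t / a\<^sup>2 * (d * R + s))"
    and m: "1 \<le> m"
    and dc: "d * c \<le> a\<^sup>2 / 128"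
    and dm: "t * d * real m \<le> a\<^sup>2 / 48"
    and sm: "t * s * real m \<le> a * R"
  shows "t * (\<Sum>k\<le>m. G k) \<le> 24 * R / a"
proof -
  \<comment> \<open>\<open>W\<close> is the weight of the variance in one step of the potential; \<open>A\<close> is a bound for
    \<open>W + q\<close>, with \<open>65 / 8 = 8 + 1 / 8\<close>, and \<open>B\<close> is the bound to be maintained for \<open>D\<close>.\<close>
  define W where "W = 8 * t / a\<^sup>2 + q"
  define A where "A = 65 / 8 * t / a\<^sup>2"
  define B where "B = 16 * R / a"
  define E where "E = R + t / a * e 0"
  have W0: "0 \<le> W" using a t q by (simp add: W_def)
  have a3: "a * a\<^sup>2 \<le> 1/8"
  proof -
    have "a ^ 3 \<le> (1/2) ^ 3" using a by (intro power_mono) auto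
    then show ?thesis by (simp add: power3_eq_cube power2_eq_square)
  qed
  have "2 * q \<le> t * a" using q by simp
  also have "\<dots> \<le> t / (8 * a\<^sup>2)"
    using a t mult_left_mono[OF a3, of t] by (simp add: field_simps)
  finally have WA: "W + q \<le> A" by (simp add: W_def A_def field_simps)
  have A0: "0 \<le> A" using a t by (simp add: A_def)
  have WA': "W \<le> A" using WA q by simp
  have dcA: "2 * d * c * A \<le> 65 / 512 * t"
  proof -
    have "d * c * A \<le> a\<^sup>2 / 128 * A" by (rule mult_right_mono[OF dc A0])
    also have "\<dots> = 65 / 1024 * t" using a by (simp add: A_def)
    finally show ?thesis by simp
  qed
  have Vw: "w * V (Suc n) \<le> w * (2 * d * D n + s) + 65 / 512 * t * G n" if w: "0 \<le> w" "w \<le> A" for w n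
  proof -
    have "w * V (Suc n) \<le> w * (2 * d * D n + 2 * d * c * G n + s)"
      by (rule mult_left_mono[OF var w(1)])
    also have "\<dots> = w * (2 * d * D n + s) + (2 * d * c * w) * G n" by (simp add: algebra_simps)
    also have "2 * d * c * w * G n \<le> 2 * d * c * A * G n"
      using w pos nonneg by (intro mult_mono mult_nonneg_nonneg) auto
    also have "\<dots> \<le> 65 / 512 * t * G n" by (rule mult_right_mono[OF dcA nonneg(3)])
    finally show ?thesis by simp
  qed
  have inv: "D N + t / a * e N - t / 8 * G N + 2 / 3 * t * (\<Sum>k<N. G k)
      \<le> E + real N * W * s + 2 * d * W * (\<Sum>k<N. D k)" for N
  proof (induction N)
    case 0
    then show ?case using nonneg(3)[of 0] t D0 by (simp add: E_def)
  next
    case (Suc N)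
    have "t / a * e (Suc N) \<le> t / a * ((1 - a) * e N + a / 8 * G (Suc N) + 8 / a * V (Suc N))"
      by (rule mult_left_mono[OF err]) (use a t in simp)
    also have "\<dots> = t / a * e N - t * e N + t / 8 * G (Suc N) + 8 * t / a\<^sup>2 * V (Suc N)"
      using a by (simp add: field_simps power2_eq_square)
    finally have "D (Suc N) + t / a * e (Suc N) - t / 8 * G (Suc N)
      \<le> D N + t / a * e N - t * G N + W * V (Suc N)"
      using descent[of N] by (simp add: W_def algebra_simps)
    moreover have "W * V (Suc N) \<le> W * (2 * d * D N + s) + 65 / 512 * t * G N"
      by (rule Vw[OF W0 WA'])
    moreover have "t * G N \<ge> 0" using t nonneg by simp
    moreover have "2 / 3 * t * (\<Sum>k<Suc N. G k) = 2 / 3 * t * (\<Sum>k<N. G k) + 2 / 3 * (t * G N)"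
      by (simp add: algebra_simps)
    moreover have "E + real (Suc N) * W * s + 2 * d * W * (\<Sum>k<Suc N. D k)
      = E + real N * W * s + 2 * d * W * (\<Sum>k<N. D k) + W * (2 * d * D N + s)"
      by (simp add: algebra_simps)
    ultimately show ?case using Suc.IH by linarith
  qed
  have E: "E \<le> 41 / 32 * R + 3 / 2 * (R / a)"
  proof -
    have m1: "1 \<le> real m" using m by simp
    have grow: "z * 1 \<le> z * real m" if "0 \<le> z" for z
      by (rule mult_left_mono[OF m1 that])
    have "t * d \<le> a\<^sup>2 / 48"
      using dm grow[of "t * d"] t pos by (simp only: mult_1_right) (smt (verit) mult_nonneg_nonneg)
    then have "t / a\<^sup>2 * (d * R) \<le> R / 48"
      using a pos mult_right_mono[of "t*d" "a\<^sup>2/48" R] by (simp add: field_simps)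
    moreover have "t * s \<le> a * R"
      using sm grow[of "t * s"] t pos by (simp only: mult_1_right) (smt (verit) mult_nonneg_nonneg)
    then have "t / a\<^sup>2 * s \<le> R / a"
      using a by (simp add: field_simps power2_eq_square)
    ultimately have "t / a\<^sup>2 * (d * R + s) \<le> R / 48 + R / a"
      unfolding distrib_left by linarith
    moreover have "E \<le> 41 / 32 * R + 3 / 2 * r" if "z \<le> R / 48 + r" "t / a * e 0 \<le> R / 4 + 3 / 2 * z" for z r
      using that unfolding E_def by linarith
    ultimately show ?thesis using e0 by blast
  qed
  have Ra: "2 * R \<le> R / a" using a pos mult_right_mono[of "2*a" 1 R] by (simp add: field_simps)
  \<comment> \<open>The potential contains \<open>- (t / 8) * G\<close> and is not obviously bounded below by \<open>D\<close>. So the last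
    step uses \<open>descent\<close> directly on top of the invariant, where \<open>t * e N \<le> (t / a) * e N\<close>;
    then the last variance enters with weight \<open>q\<close> only, and the total weight is \<open>N * W + q\<close>.\<close>
  have step: "D (Suc N) + 2 / 3 * t * (\<Sum>k<Suc N. G k) \<le> B"
    if N: "N \<le> m" and DB: "\<And>k. k \<le> N \<Longrightarrow> D k \<le> B" for N
  proof -
    have ta: "t * e N \<le> t / a * e N"
      using a t nonneg(2)[of N] by (intro mult_right_mono) (auto simp: field_simps)
    have qV: "q * V (Suc N) \<le> q * (2 * d * D N + s) + 65 / 512 * t * G N"
      by (rule Vw) (use q WA W0 in auto)
    have tG: "0 \<le> t * G N" using t nonneg by simp
    have "D (Suc N) + 2 / 3 * t * (\<Sum>k<Suc N. G k)
      \<le> E + real N * W * s + 2 * d * W * (\<Sum>k<N. D k) + q * (2 * d * D N + s)"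
    proof -
      have "2 / 3 * t * (\<Sum>k<Suc N. G k) = 2 / 3 * t * (\<Sum>k<N. G k) + 2 / 3 * (t * G N)"
        by (simp add: algebra_simps)
      then show ?thesis using inv[of N] descent[of N] ta qV tG by linarith
    qed
    also have "2 * d * W * (\<Sum>k<N. D k) \<le> 2 * d * W * (real N * B)"
      using pos W0 sum_bounded_above[of "{..<N}" D B] DB
      by (intro mult_left_mono mult_nonneg_nonneg) auto
    also have "q * (2 * d * D N + s) \<le> q * (2 * d * B + s)"
      using q pos DB[of N] by (intro mult_left_mono add_right_mono mult_nonneg_nonneg) auto
    also have "E + real N * W * s + 2 * d * W * (real N * B) + q * (2 * d * B + s)
      = E + (real N * W + q) * (s + 2 * d * B)" by (simp add: algebra_simps)
    also have "(real N * W + q) * (s + 2 * d * B) \<le> (real m * A) * (s + 2 * d * B)"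
    proof (rule mult_right_mono)
      have "real N * W + q \<le> real m * W + real m * q"
        using N m W0 q mult_right_mono[of 1 "real m" q] by (intro add_mono mult_right_mono) auto
      also have "\<dots> \<le> real m * A" using WA by (simp add: distrib_left[symmetric] mult_left_mono)
      finally show "real N * W + q \<le> real m * A" .
      show "0 \<le> s + 2 * d * B" using pos a by (simp add: B_def)
    qed
    also have "real m * A * (s + 2 * d * B)
      = 65 / 8 / a\<^sup>2 * (t * s * real m) + 65 / 4 / a\<^sup>2 * B * (t * d * real m)"
    proof -
      have "real m * (u * t) * (s + 2 * d * B) = u * (t * s * real m) + 2 * u * B * (t * d * real m)" for u
        by (simp add: algebra_simps)
      from this[of "65 / 8 / a\<^sup>2"] show ?thesis by (simp add: A_def)
    qed
    also have "65 / 8 / a\<^sup>2 * (t * s * real m) \<le> 65 / 8 / a\<^sup>2 * (a * R)"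
      by (rule mult_left_mono[OF sm]) simp
    also have "65 / 4 / a\<^sup>2 * B * (t * d * real m) \<le> 65 / 4 / a\<^sup>2 * B * (a\<^sup>2 / 48)"
      by (rule mult_left_mono[OF dm]) (use pos a in \<open>simp add: B_def\<close>)
    also have "65 / 8 / a\<^sup>2 * (a * R) = 65 / 8 * (R / a)"
      using a by (simp add: field_simps power2_eq_square)
    also have "65 / 4 / a\<^sup>2 * B * (a\<^sup>2 / 48) = 65 / 12 * (R / a)"
      using a by (simp add: B_def field_simps)
    also have "E + (65 / 8 * (R / a) + 65 / 12 * (R / a)) \<le> B"
      using E Ra pos by (simp add: B_def)
    finally show ?thesis by simp
  qed
  have DB: "D n \<le> B" if "n \<le> Suc m" for n
    using that
  proof (induction n rule: less_induct)
    case (less n)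
    show ?case
    proof (cases n)
      case 0
      then show ?thesis using D0 Ra pos by (simp add: B_def)
    next
      case (Suc N)
      have "D (Suc N) + 2 / 3 * t * (\<Sum>k<Suc N. G k) \<le> B"
        by (rule step) (use less Suc in auto)
      moreover have "0 \<le> 2 / 3 * t * (\<Sum>k<Suc N. G k)"
        using t nonneg by (intro mult_nonneg_nonneg sum_nonneg) auto
      ultimately show ?thesis using Suc by simp
    qed
  qed
  have "D (Suc m) + 2 / 3 * t * (\<Sum>k<Suc m. G k) \<le> B"
    by (rule step) (use DB in auto)
  then show ?thesis using nonneg(1)[of "Suc m"] by (simp add: B_def lessThan_Suc_atMost)
qed

section \<open>Energy bound for past extragradient with unbiased estimators\<close>

text \<open>Convexity of the square, with weights \<open>1 - a\<close> on \<open>b\<close> and \<open>a\<close> on \<open>u / a\<close>. It squares the triangle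
  inequality for the extrapolation error without losing the contraction factor \<open>1 - a\<close>.\<close>
lemma convex_square_bound:
  fixes a b u N :: real
  assumes "0 < a" "a \<le> 1" "0 \<le> N" "N \<le> (1 - a) * b + u"
  shows "N\<^sup>2 \<le> (1 - a) * b\<^sup>2 + u\<^sup>2 / a"
proof -
  have "N\<^sup>2 \<le> ((1 - a) * b + u)\<^sup>2" using assms by (intro power_mono) auto
  also have "\<dots> = (1 - a) * b\<^sup>2 + u\<^sup>2 / a - (1 - a) * (a * b - u)\<^sup>2 / a"
    using assms(1) by (simp add: field_simps power2_eq_square)
  also have "\<dots> \<le> (1 - a) * b\<^sup>2 + u\<^sup>2 / a"
    using assms by simp
  finally show ?thesis .
qed

text \<open>Indices are shifted so that they start at \<open>0\<close>: \<open>y 0\<close> is the point before the first iteration,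
  \<open>y (Suc n)\<close> is extrapolated from \<open>X n\<close>, and \<open>g n\<close> is the estimate taken at \<open>y n\<close>.

  Expanding \<open>X (Suc n) - xs\<close> and splitting \<open>X n - xs\<close> into \<open>y (Suc n) - xs\<close> and \<open>\<gamma> *\<^sub>R g n\<close>, the first part
  is bounded by the weak Minty condition, while the second yields, by polarization,
  \<open>- \<omega> * \<gamma> * (norm (g n))\<^sup>2\<close> and \<open>\<omega> * \<gamma>\<close> times the squared extrapolation error. The remaining multiple of
  \<open>(norm (F (y (Suc n))))\<^sup>2\<close>, \<open>\<omega> * (2 * \<rho> + \<omega> - \<gamma>)\<close>, is nonpositive but possibly tiny, so the useful decrease is
  that of the energy of \<open>g\<close>. The Lipschitz bound turns the change from \<open>y (Suc n)\<close> to \<open>y (Suc (Suc n))\<close>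
  into the damped recursion for the error, with \<open>a = 1 - L * \<gamma>\<close> and \<open>4 * (L * \<omega>) \<le> a\<close>. Finally the energy
  of \<open>g\<close> dominates that of \<open>F\<close> because the estimator is unbiased.\<close>
lemma past_extragradient_energy_bound:
  fixes X y g :: "nat \<Rightarrow> 'w \<Rightarrow> 'a::euclidean_space" and F :: "'a \<Rightarrow> 'a"
    and L \<rho> \<gamma> \<omega> d s :: real and m :: nat
  assumes "prob_space M"
    and L: "0 < L" and lip: "L-lipschitz_on UNIV F" and zero: "F xs = 0"
    and minty: "\<And>x. - \<rho> * (norm (F x))\<^sup>2 \<le> F x \<bullet> (x - xs)"
    and \<gamma>: "1 / (2 * L) \<le> \<gamma>" "\<gamma> < 1 / L"
    and \<omega>: "0 < \<omega>" "\<omega> \<le> \<gamma> - 2 * \<rho>" "\<omega> \<le> 1 / (4 * L) - \<gamma> / 4"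
    and init: "\<And>w. w \<in> space M \<Longrightarrow> X 0 w = x0" "\<And>w. w \<in> space M \<Longrightarrow> y 0 w = x0"
    and extrapolate: "\<And>n w. w \<in> space M \<Longrightarrow> y (Suc n) w = X n w - \<gamma> *\<^sub>R g n w"
    and update: "\<And>n w. w \<in> space M \<Longrightarrow> X (Suc n) w = X n w - \<omega> *\<^sub>R g (Suc n) w"
    and sq: "\<And>n. square_integrable M (X n)" "\<And>n. square_integrable M (y n)"
      "\<And>n. square_integrable M (g n)"
    and unbiased_self: "\<And>n. (\<integral>w. (g n w - F (y n w)) \<bullet> F (y n w) \<partial>M) = 0"
    and unbiased_iterate: "\<And>n. (\<integral>w. (g (Suc n) w - F (y (Suc n) w)) \<bullet> (X n w - xs) \<partial>M) = 0"
    and noise: "\<And>n. (\<integral>w. (norm (g n w - F (y n w)))\<^sup>2 \<partial>M)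
      \<le> d * (\<integral>w. (norm (y n w - xs))\<^sup>2 \<partial>M) + s"
    and pos: "0 \<le> d" "0 \<le> s" and m: "1 \<le> m"
    and d1: "d * \<gamma>\<^sup>2 \<le> (1 - L * \<gamma>)\<^sup>2 / 128"
    and d2: "\<omega> * \<gamma> * d * real m \<le> (1 - L * \<gamma>)\<^sup>2 / 48"
    and s1: "\<omega> * \<gamma> * s * real m \<le> (1 - L * \<gamma>) * (norm (x0 - xs))\<^sup>2"
  shows "\<omega> * \<gamma> * (\<Sum>n\<le>m. \<integral>w. (norm (F (y n w)))\<^sup>2 \<partial>M) \<le> 24 * (norm (x0 - xs))\<^sup>2 / (1 - L * \<gamma>)"
proof -
  interpret prob_space M by fact
  define a where "a = 1 - L * \<gamma>"
  define t where "t = \<omega> * \<gamma>"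
  define R where "R = (norm (x0 - xs))\<^sup>2"
  define D where "D n = (\<integral>w. (norm (X n w - xs))\<^sup>2 \<partial>M)" for n
  define G where "G n = (\<integral>w. (norm (g n w))\<^sup>2 \<partial>M)" for n
  define e where "e n = (\<integral>w. (norm (F (y (Suc n) w) - g n w))\<^sup>2 \<partial>M)" for n
  define V where "V n = (\<integral>w. (norm (g n w - F (y n w)))\<^sup>2 \<partial>M)" for n
  define P where "P n = (\<integral>w. (norm (F (y n w)))\<^sup>2 \<partial>M)" for n
  have a: "0 < a" "a \<le> 1/2" and \<gamma>0: "0 < \<gamma>"
    using L \<gamma> by (auto simp: a_def field_simps intro: order_less_le_trans[of 0 "1/(2*L)"])
  have t: "0 < t" using \<omega> \<gamma>0 by (simp add: t_def)
  have L\<omega>: "L * \<omega> \<le> a / 4" using \<omega>(3) L by (simp add: a_def field_simps)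
  have L\<gamma>: "L * \<gamma> = 1 - a" by (simp add: a_def)
  have q: "\<omega>\<^sup>2 \<le> t * a / 2"
  proof -
    have "\<omega> * (L * \<omega>) \<le> \<omega> * (a / 4)" using L\<omega> \<omega> by (intro mult_left_mono) auto
    also have "\<omega> * (a / 4) \<le> \<omega> * (a / 4) * (2 * (L * \<gamma>))"
      using a \<omega> L\<gamma> mult_left_mono[of 1 "2 * (1 - a)" "\<omega> * (a / 4)"] by simp
    finally have "L * \<omega>\<^sup>2 \<le> L * (t * a / 2)" by (simp add: t_def power2_eq_square algebra_simps)
    then show ?thesis using L by simp
  qed
  have sqF: "square_integrable M (\<lambda>w. F (y n w))" for n
    by (rule square_integrable_Lipschitz[OF finite_measure_axioms sq(2) lip])
  note sq_intros = square_integrable_diff square_integrable_const sqF sq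
  have sqN: "square_integrable M (\<lambda>w. g n w - F (y n w))"
    "square_integrable M (\<lambda>w. F (y (Suc n) w) - g n w)"
    "square_integrable M (\<lambda>w. X n w - xs)" "square_integrable M (\<lambda>w. y n w - xs)" for n
    by (intro sq_intros)+
  note int = square_integrableD(2)[OF sqN(1)] square_integrableD(2)[OF sqN(2)]
    square_integrableD(2)[OF sqN(3)] square_integrableD(2)[OF sqN(4)]
    square_integrableD(2)[OF sq(3)] square_integrableD(2)[OF sqF]
    square_integrable_inner[OF sqN(1) sqF] square_integrable_inner[OF sqN(1) sqN(3)]
  have Gsplit: "G n = P n + V n" for n
  proof -
    have "(norm (g n w))\<^sup>2 = (norm (F (y n w)))\<^sup>2 + (norm (g n w - F (y n w)))\<^sup>2
        + 2 * ((g n w - F (y n w)) \<bullet> F (y n w))" for w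
      by (simp add: power2_norm_eq_inner inner_simps inner_commute)
    then have "G n = (\<integral>w. (norm (F (y n w)))\<^sup>2 + (norm (g n w - F (y n w)))\<^sup>2
        + 2 * ((g n w - F (y n w)) \<bullet> F (y n w)) \<partial>M)" by (simp add: G_def)
    also have "\<dots> = P n + V n" using int by (simp add: P_def V_def unbiased_self)
    finally show ?thesis .
  qed
  have descent: "D (Suc n) \<le> D n - t * G n + t * e n + \<omega>\<^sup>2 * V (Suc n)" for n
  proof -
    let ?N = "\<lambda>w. g (Suc n) w - F (y (Suc n) w)"
    have "D (Suc n) \<le> (\<integral>w. (norm (X n w - xs))\<^sup>2 - t * (norm (g n w))\<^sup>2
        + t * (norm (F (y (Suc n) w) - g n w))\<^sup>2 + \<omega>\<^sup>2 * (norm (?N w))\<^sup>2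
        - 2 * \<omega> * (?N w \<bullet> (X n w - xs)) + 2 * \<omega>\<^sup>2 * (?N w \<bullet> F (y (Suc n) w)) \<partial>M)"
      unfolding D_def
    proof (rule integral_mono)
      fix w assume w: "w \<in> space M"
      define x f h z where "x = X n w - xs" and "f = F (y (Suc n) w)" and "h = g (Suc n) w" and "z = g n w"
      have step: "X (Suc n) w - xs = x - \<omega> *\<^sub>R h"
        using update[OF w, of n] by (simp add: x_def h_def)
      have "y (Suc n) w - xs = x - \<gamma> *\<^sub>R z" using extrapolate[OF w, of n] by (simp add: x_def z_def)
      then have "- \<rho> * (norm f)\<^sup>2 \<le> f \<bullet> (x - \<gamma> *\<^sub>R z)"
        using minty[of "y (Suc n) w"] by (simp add: f_def)
      then have "2 * \<omega> * (- \<rho> * (norm f)\<^sup>2) \<le> 2 * \<omega> * (f \<bullet> x - \<gamma> * (f \<bullet> z))"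
        using \<omega> by (intro mult_left_mono) (auto simp: inner_simps)
      moreover have "2 * (f \<bullet> z) = (norm f)\<^sup>2 + (norm z)\<^sup>2 - (norm (f - z))\<^sup>2"
        by (simp add: power2_norm_eq_inner inner_simps inner_commute)
      then have "2 * \<omega> * (\<gamma> * (f \<bullet> z)) = t * ((norm f)\<^sup>2 + (norm z)\<^sup>2 - (norm (f - z))\<^sup>2)"
        by (simp add: t_def)
      moreover have "0 \<le> \<omega> * (\<gamma> - 2 * \<rho> - \<omega>) * (norm f)\<^sup>2" using \<omega> by simp
      moreover have "(norm (x - \<omega> *\<^sub>R h))\<^sup>2 = (norm x)\<^sup>2 - 2 * \<omega> * (f \<bullet> x)
          + \<omega>\<^sup>2 * (norm f)\<^sup>2 + \<omega>\<^sup>2 * (norm (h - f))\<^sup>2 - 2 * \<omega> * ((h - f) \<bullet> x)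
          + 2 * \<omega>\<^sup>2 * ((h - f) \<bullet> f)"
        unfolding power2_norm_eq_inner
        by (simp add: inner_simps inner_commute algebra_simps power2_eq_square)
      ultimately show "(norm (X (Suc n) w - xs))\<^sup>2 \<le> (norm (X n w - xs))\<^sup>2 - t * (norm (g n w))\<^sup>2
        + t * (norm (F (y (Suc n) w) - g n w))\<^sup>2 + \<omega>\<^sup>2 * (norm (?N w))\<^sup>2
        - 2 * \<omega> * (?N w \<bullet> (X n w - xs)) + 2 * \<omega>\<^sup>2 * (?N w \<bullet> F (y (Suc n) w))"
        unfolding step unfolding x_def[symmetric] f_def[symmetric] h_def[symmetric] z_def[symmetric]
        by (simp add: t_def algebra_simps power2_eq_square)
    qed (use int in simp_all)
    also have "\<dots> = D n - t * G n + t * e n + \<omega>\<^sup>2 * V (Suc n)"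
      using int by (simp add: D_def G_def e_def V_def unbiased_self unbiased_iterate)
    finally show ?thesis .
  qed
  have err: "e (Suc n) \<le> (1 - a) * e n + a / 8 * G (Suc n) + 8 / a * V (Suc n)" for n
  proof -
    let ?N = "\<lambda>w. g (Suc n) w - F (y (Suc n) w)"
    have "e (Suc n) \<le> (\<integral>w. (1 - a) * (norm (F (y (Suc n) w) - g n w))\<^sup>2
        + a / 8 * (norm (g (Suc n) w))\<^sup>2 + 8 / a * (norm (?N w))\<^sup>2 \<partial>M)"
      unfolding e_def
    proof (rule integral_mono)
      fix w assume w: "w \<in> space M"
      define f h z where "f = F (y (Suc n) w)" and "h = g (Suc n) w" and "z = g n w"
      \<comment> \<open>Centred at \<open>f\<close>, the step splits into the update, the sampling noise, and the previous
        extrapolation error.\<close>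
      have "y (Suc (Suc n)) w - y (Suc n) w = - (\<omega> *\<^sub>R h) - \<gamma> *\<^sub>R (h - f) - \<gamma> *\<^sub>R (f - z)"
        using extrapolate[OF w, of "Suc n"] extrapolate[OF w, of n] update[OF w, of n]
        by (simp add: h_def z_def algebra_simps)
      then have "norm (y (Suc (Suc n)) w - y (Suc n) w)
          \<le> \<omega> * norm h + \<gamma> * norm (h - f) + \<gamma> * norm (f - z)"
        using norm_triangle_ineq4[of "- (\<omega> *\<^sub>R h) - \<gamma> *\<^sub>R (h - f)" "\<gamma> *\<^sub>R (f - z)"]
          norm_triangle_ineq4[of "- (\<omega> *\<^sub>R h)" "\<gamma> *\<^sub>R (h - f)"] \<omega>(1) \<gamma>0 by simp
      then have "L * norm (y (Suc (Suc n)) w - y (Suc n) w)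
          \<le> L * (\<omega> * norm h + \<gamma> * norm (h - f) + \<gamma> * norm (f - z))"
        using L by simp
      then have "norm (F (y (Suc (Suc n)) w) - f)
          \<le> (L * \<omega>) * norm h + (L * \<gamma>) * norm (h - f) + (L * \<gamma>) * norm (f - z)"
        using lipschitz_onD[OF lip, of "y (Suc (Suc n)) w" "y (Suc n) w"]
        by (simp add: dist_norm f_def algebra_simps)
      moreover have "(L * \<omega>) * norm h \<le> a / 4 * norm h" by (intro mult_right_mono L\<omega>) simp
      moreover have "(L * \<gamma>) * norm (h - f) \<le> 1 * norm (h - f)"
        by (intro mult_right_mono) (use a L\<gamma> in auto)
      moreover have "norm (F (y (Suc (Suc n)) w) - h)
          \<le> norm (F (y (Suc (Suc n)) w) - f) + norm (h - f)"
        using norm_triangle_ineq4[of "F (y (Suc (Suc n)) w) - f" "h - f"] by simp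
      ultimately have "norm (F (y (Suc (Suc n)) w) - h)
          \<le> (1 - a) * norm (f - z) + (a / 4 * norm h + 2 * norm (h - f))"
        by (simp add: L\<gamma>)
      from convex_square_bound[OF _ _ _ this]
      have "(norm (F (y (Suc (Suc n)) w) - h))\<^sup>2
          \<le> (1 - a) * (norm (f - z))\<^sup>2 + (a / 4 * norm h + 2 * norm (h - f))\<^sup>2 / a"
        using a by simp
      also have "(a / 4 * norm h + 2 * norm (h - f))\<^sup>2 / a
          \<le> (2 * (a / 4 * norm h)\<^sup>2 + 2 * (2 * norm (h - f))\<^sup>2) / a"
        using a norm_add_square_le[of "a / 4 * norm h" "2 * norm (h - f)"]
        by (intro divide_right_mono) auto
      also have "\<dots> = a / 8 * (norm h)\<^sup>2 + 8 / a * (norm (h - f))\<^sup>2"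
        using a by (simp add: field_simps power2_eq_square)
      finally show "(norm (F (y (Suc (Suc n)) w) - g (Suc n) w))\<^sup>2
          \<le> (1 - a) * (norm (F (y (Suc n) w) - g n w))\<^sup>2
            + a / 8 * (norm (g (Suc n) w))\<^sup>2 + 8 / a * (norm (?N w))\<^sup>2"
        by (simp add: f_def h_def z_def)
    qed (use int in simp_all)
    also have "\<dots> = (1 - a) * e n + a / 8 * G (Suc n) + 8 / a * V (Suc n)"
      using int by (simp add: e_def G_def V_def)
    finally show ?thesis .
  qed
  have var: "V (Suc n) \<le> 2 * d * D n + 2 * d * \<gamma>\<^sup>2 * G n + s" for n
  proof -
    have "(\<integral>w. (norm (y (Suc n) w - xs))\<^sup>2 \<partial>M)
        \<le> (\<integral>w. 2 * (norm (X n w - xs))\<^sup>2 + 2 * \<gamma>\<^sup>2 * (norm (g n w))\<^sup>2 \<partial>M)"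
    proof (rule integral_mono)
      fix w assume w: "w \<in> space M"
      have eq: "y (Suc n) w - xs = (X n w - xs) + (- \<gamma>) *\<^sub>R g n w" using extrapolate[OF w, of n] by simp
      show "(norm (y (Suc n) w - xs))\<^sup>2 \<le> 2 * (norm (X n w - xs))\<^sup>2 + 2 * \<gamma>\<^sup>2 * (norm (g n w))\<^sup>2"
        unfolding eq using norm_add_square_le[of "X n w - xs" "(- \<gamma>) *\<^sub>R g n w"] by (simp add: power_mult_distrib)
    qed (use int in simp_all)
    also have "\<dots> = 2 * D n + 2 * \<gamma>\<^sup>2 * G n" using int by (simp add: D_def G_def)
    finally have "d * (\<integral>w. (norm (y (Suc n) w - xs))\<^sup>2 \<partial>M) \<le> d * (2 * D n + 2 * \<gamma>\<^sup>2 * G n)"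
      using pos by (intro mult_left_mono)
    then show ?thesis using noise[of "Suc n"] by (simp add: V_def algebra_simps)
  qed
  have D0: "D 0 = R"
    unfolding D_def R_def using init by (simp add: prob_space cong: Bochner_Integration.integral_cong)
  have V0: "V 0 \<le> d * R + s"
  proof -
    have "(\<integral>w. (norm (y 0 w - xs))\<^sup>2 \<partial>M) = R"
      unfolding R_def using init by (simp add: prob_space cong: Bochner_Integration.integral_cong)
    then show ?thesis using noise[of 0] by (simp add: V_def)
  qed
  have P0: "P 0 \<le> L\<^sup>2 * R"
  proof -
    have "P 0 = (norm (F x0))\<^sup>2"
      unfolding P_def using init by (simp add: prob_space cong: Bochner_Integration.integral_cong)
    moreover have "norm (F x0) \<le> L * norm (x0 - xs)"
      using lipschitz_onD[OF lip, of x0 xs] zero by (simp add: dist_norm)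
    then have "(norm (F x0))\<^sup>2 \<le> (L * norm (x0 - xs))\<^sup>2" by (intro power_mono) auto
    ultimately show ?thesis by (simp add: R_def power_mult_distrib)
  qed
  \<comment> \<open>The division by \<open>a\<close> does not blow up the initial energy, at most \<open>L\<^sup>2 * R\<close> without noise: one factor
    \<open>L\<close> meets \<open>\<omega>\<close>, and \<open>L * \<omega> \<le> a / 4\<close>.\<close>
  have e0: "t / a * e 0 \<le> R / 4 + 3 / 2 * (t / a\<^sup>2 * (d * R + s))"
  proof -
    have "e 0 \<le> (\<integral>w. (1 - a) * (norm (g 0 w))\<^sup>2 + 1 / a * (norm (g 0 w - F (y 0 w)))\<^sup>2 \<partial>M)"
      unfolding e_def
    proof (rule integral_mono)
      fix w assume w: "w \<in> space M"
      have "norm (F (y 1 w) - F (y 0 w)) \<le> L * norm (y 1 w - y 0 w)"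
        using lipschitz_onD[OF lip, of "y 1 w" "y 0 w"] by (simp add: dist_norm)
      also have "\<dots> = (1 - a) * norm (g 0 w)"
        using extrapolate[OF w, of 0] init[OF w] \<gamma>0 by (simp add: a_def)
      finally have "norm (F (y 1 w) - g 0 w) \<le> (1 - a) * norm (g 0 w) + norm (g 0 w - F (y 0 w))"
        using norm_triangle_ineq4[of "F (y 1 w) - F (y 0 w)" "g 0 w - F (y 0 w)"] by simp
      from convex_square_bound[OF _ _ _ this] a
      show "(norm (F (y (Suc 0) w) - g 0 w))\<^sup>2
          \<le> (1 - a) * (norm (g 0 w))\<^sup>2 + 1 / a * (norm (g 0 w - F (y 0 w)))\<^sup>2" by simp
    qed (use int in simp_all)
    also have "\<dots> = (1 - a) * G 0 + 1 / a * V 0" using int by (simp add: G_def V_def)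
    also have "\<dots> \<le> (1 - a) * (L\<^sup>2 * R) + (1 - a + 1 / a) * V 0"
      using mult_left_mono[OF P0, of "1 - a"] a by (simp add: Gsplit algebra_simps)
    finally have "t / a * e 0 \<le> t / a * ((1 - a) * (L\<^sup>2 * R) + (1 - a + 1 / a) * V 0)"
      using a t by (intro mult_left_mono) auto
    also have "\<dots> = (L * \<omega>) / a * ((1 - a) * (L * \<gamma>)) * R + (a * (1 - a) + 1) * (t / a\<^sup>2 * V 0)"
      using a by (simp add: t_def field_simps power2_eq_square)
    also have "(L * \<omega>) / a * ((1 - a) * (L * \<gamma>)) * R \<le> 1 / 4 * 1 * R"
    proof (intro mult_right_mono mult_mono)
      show "L * \<omega> / a \<le> 1 / 4" using L\<omega> a by (simp add: field_simps)
      show "(1 - a) * (L * \<gamma>) \<le> 1" unfolding L\<gamma> using a by (intro mult_le_one) auto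
      show "0 \<le> (1 - a) * (L * \<gamma>)" unfolding L\<gamma> using a by simp
    qed (simp_all add: R_def)
    also have "(a * (1 - a) + 1) * (t / a\<^sup>2 * V 0) \<le> 3 / 2 * (t / a\<^sup>2 * (d * R + s))"
    proof (rule mult_mono)
      have "a * (1 - a) \<le> 1 / 2 * 1" using a by (intro mult_mono) auto
      then show "a * (1 - a) + 1 \<le> 3 / 2" by simp
      show "t / a\<^sup>2 * V 0 \<le> t / a\<^sup>2 * (d * R + s)" using V0 t by (intro mult_left_mono) auto
      show "0 \<le> t / a\<^sup>2 * V 0" using t by (simp add: V_def)
    qed simp
    finally show ?thesis by simp
  qed
  have "t * (\<Sum>n\<le>m. G n) \<le> 24 * R / a"
  proof (rule damped_descent_sum_bound[where D = D and e = e and V = V and q = "\<omega>\<^sup>2" and d = d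
        and c = "\<gamma>\<^sup>2" and s = s])
    show "t * d * real m \<le> a\<^sup>2 / 48" "t * s * real m \<le> a * R" "d * \<gamma>\<^sup>2 \<le> a\<^sup>2 / 128"
      using d1 d2 s1 by (simp_all add: t_def a_def R_def)
  qed (use a t q pos D0 e0 m descent err var in \<open>auto simp: D_def e_def G_def R_def\<close>)
  moreover have "P n \<le> G n" for n unfolding Gsplit by (simp add: V_def)
  then have "t * (\<Sum>n\<le>m. P n) \<le> t * (\<Sum>n\<le>m. G n)"
    using t by (intro mult_left_mono sum_mono) auto
  ultimately show ?thesis by (simp add: t_def P_def R_def a_def)
qed

section \<open>Sampled and mini-batched operators\<close>

lemma stoch_op_measurable [measurable]:
  fixes Fs :: "'n::finite \<Rightarrow> real^'d \<Rightarrow> real^'d"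
  assumes Fs[measurable]: "\<And>i. Fs i \<in> borel_measurable borel"
    and [measurable]: "V \<in> borel_measurable N" "Y \<in> borel_measurable N"
  shows "(\<lambda>w. stoch_op Fs (V w) (Y w)) \<in> borel_measurable N"
proof -
  have [measurable]: "(\<lambda>w. V w $ i) \<in> borel_measurable N" for i
    by (rule borel_measurable_continuous_on[OF _ \<open>V \<in> _\<close>]) (intro continuous_intros)
  show ?thesis unfolding stoch_op_def by measurable
qed

lemma minibatch_op_measurable:
  fixes Fs :: "'n::finite \<Rightarrow> real^'d \<Rightarrow> real^'d"
  assumes Fs: "\<And>i. Fs i \<in> borel_measurable borel"
    and V: "\<And>j. j \<in> {1..\<tau>} \<Longrightarrow> (\<lambda>w. V w j) \<in> borel_measurable N" and Y: "Y \<in> borel_measurable N"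
  shows "(\<lambda>w. minibatch_op Fs \<tau> (V w) (Y w)) \<in> borel_measurable N"
  unfolding minibatch_op_def
  by (intro borel_measurable_scaleR borel_measurable_const borel_measurable_sum stoch_op_measurable Fs V Y)

lemma minibatch_op_restrict: "minibatch_op Fs \<tau> (restrict u {1..\<tau>}) x = minibatch_op Fs \<tau> u x"
  unfolding minibatch_op_def by simp

text \<open>A coordinate of the sampling vector that were not integrable would have mean \<open>0\<close>, not \<open>1\<close>.\<close>
lemma stoch_op_mean:
  fixes Fs :: "'n::finite \<Rightarrow> real^'d \<Rightarrow> real^'d"
  assumes D: "sampling_distribution D"
  shows "integrable D (\<lambda>v. stoch_op Fs v y)" "(\<integral>v. stoch_op Fs v y \<partial>D) = avg_op Fs y"
proof -
  have mean: "(\<integral>v. v $ i \<partial>D) = 1" for i using D by (simp add: sampling_distribution_def)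
  have int: "integrable D (\<lambda>v. v $ i)" for i
    using mean[of i] not_integrable_integral_eq[of D "\<lambda>v. v $ i"] by fastforce
  show "integrable D (\<lambda>v. stoch_op Fs v y)"
    unfolding stoch_op_def using int by simp
  show "(\<integral>v. stoch_op Fs v y \<partial>D) = avg_op Fs y"
    unfolding stoch_op_def avg_op_def using int by (simp add: mean)
qed

text \<open>The deviation at \<open>y\<close> is the residual controlled by \<open>expected_residual\<close> plus the sample at \<open>xs\<close>,
  since the averaged operator vanishes there. The factor \<open>2\<close> from splitting the square cancels the
  \<open>1 / 2\<close> in the residual condition.\<close>
lemma stoch_op_noise:
  fixes Fs :: "'n::finite \<Rightarrow> real^'d \<Rightarrow> real^'d"
  assumes D: "sampling_distribution D" and Fs: "\<And>i. Fs i \<in> borel_measurable borel"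
    and zero: "avg_op Fs xs = 0" and er: "expected_residual D Fs \<delta> xs"
    and star: "integrable D (\<lambda>u. (norm (stoch_op Fs u xs))\<^sup>2)"
  shows "square_integrable D (\<lambda>v. stoch_op Fs v y - avg_op Fs y)"
    and "(\<integral>v. (norm (stoch_op Fs v y - avg_op Fs y))\<^sup>2 \<partial>D)
      \<le> \<delta> * (norm (y - xs))\<^sup>2 + 2 * sigma_sq D Fs xs"
proof -
  interpret prob_space D using D by (simp add: sampling_distribution_def)
  have [measurable_cong]: "sets D = sets borel" using D by (simp add: sampling_distribution_def)
  note [measurable] = Fs
  let ?r = "\<lambda>v. (stoch_op Fs v y - stoch_op Fs v xs) - (avg_op Fs y - avg_op Fs xs)"
  have r: "integrable D (\<lambda>v. (norm (?r v))\<^sup>2)" "(\<integral>v. (norm (?r v))\<^sup>2 \<partial>D) \<le> \<delta> / 2 * (norm (y - xs))\<^sup>2"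
    using er by (simp_all add: expected_residual_def Let_def)
  have eq: "stoch_op Fs v y - avg_op Fs y = ?r v + stoch_op Fs v xs" for v by (simp add: zero)
  have "square_integrable D ?r" "square_integrable D (\<lambda>v. stoch_op Fs v xs)"
    using r(1) star by (auto simp: square_integrable_def)
  from square_integrable_add[OF this] show sq: "square_integrable D (\<lambda>v. stoch_op Fs v y - avg_op Fs y)"
    unfolding eq .
  have "(\<integral>v. (norm (stoch_op Fs v y - avg_op Fs y))\<^sup>2 \<partial>D)
      \<le> (\<integral>v. 2 * (norm (?r v))\<^sup>2 + 2 * (norm (stoch_op Fs v xs))\<^sup>2 \<partial>D)"
  proof (rule integral_mono)
    show "(norm (stoch_op Fs v y - avg_op Fs y))\<^sup>2
      \<le> 2 * (norm (?r v))\<^sup>2 + 2 * (norm (stoch_op Fs v xs))\<^sup>2" for v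
      unfolding eq by (rule norm_add_square_le)
  qed (use r star square_integrableD[OF sq] in simp_all)
  also have "\<dots> = 2 * (\<integral>v. (norm (?r v))\<^sup>2 \<partial>D) + 2 * sigma_sq D Fs xs"
    using r star by (simp add: sigma_sq_def)
  finally show "(\<integral>v. (norm (stoch_op Fs v y - avg_op Fs y))\<^sup>2 \<partial>D)
      \<le> \<delta> * (norm (y - xs))\<^sup>2 + 2 * sigma_sq D Fs xs" using r(2) by simp
qed

lemma minibatch_op_noise:
  fixes Fs :: "'n::finite \<Rightarrow> real^'d \<Rightarrow> real^'d"
  assumes D: "sampling_distribution D" and Fs: "\<And>i. Fs i \<in> borel_measurable borel"
    and zero: "avg_op Fs xs = 0" and er: "expected_residual D Fs \<delta> xs"
    and star: "integrable D (\<lambda>u. (norm (stoch_op Fs u xs))\<^sup>2)" and \<tau>: "1 \<le> \<tau>"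
  defines "B \<equiv> PiM {1..\<tau>} (\<lambda>_. D)"
  shows "square_integrable B (\<lambda>z. minibatch_op Fs \<tau> z y - avg_op Fs y)"
    and "(\<integral>z. minibatch_op Fs \<tau> z y - avg_op Fs y \<partial>B) = 0"
    and "(\<integral>z. (norm (minibatch_op Fs \<tau> z y - avg_op Fs y))\<^sup>2 \<partial>B)
      \<le> \<delta> / real \<tau> * (norm (y - xs))\<^sup>2 + 2 * sigma_sq D Fs xs / real \<tau>"
proof -
  interpret D: prob_space D using D by (simp add: sampling_distribution_def)
  have Dsets[measurable_cong]: "sets D = sets borel" using D by (simp add: sampling_distribution_def)
  interpret B: prob_space B unfolding B_def by (intro prob_space_PiM D.prob_space_axioms)
  define f where "f v = stoch_op Fs v y - avg_op Fs y" for v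
  note noise = stoch_op_noise[OF D Fs zero er star, of y, folded f_def]
  have f[measurable]: "f \<in> borel_measurable D" by (rule square_integrableD[OF noise(1)])
  have mean: "(\<integral>v. f v \<partial>D) = 0"
    unfolding f_def by (simp add: stoch_op_mean[OF D] D.prob_space)
  have eq: "minibatch_op Fs \<tau> z y - avg_op Fs y = (1 / real \<tau>) *\<^sub>R (\<Sum>j\<in>{1..\<tau>}. f (z j))" for z
    using \<tau> by (simp add: minibatch_op_def f_def sum_subtractf scaleR_right_diff_distrib sum_constant_scaleR
        del: sum_constant)
  note S = iid_centred_sum_second_moment[OF D.prob_space_axioms noise(1) mean finite_atLeastAtMost,
      of 1 \<tau>, folded B_def]
  show "square_integrable B (\<lambda>z. minibatch_op Fs \<tau> z y - avg_op Fs y)"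
    unfolding eq using S by (intro square_integrable_scaleR) simp
  have comp: "integrable B (\<lambda>z. f (z j))" "(\<integral>z. f (z j) \<partial>B) = 0" if "j \<in> {1..\<tau>}" for j
  proof -
    have m[measurable]: "(\<lambda>z. z j) \<in> measurable B D"
      unfolding B_def using that by (rule measurable_component_singleton)
    have d: "distr B D (\<lambda>z. z j) = D"
      unfolding B_def using that D.prob_space_axioms by (intro distr_PiM_component) auto
    show "(\<integral>z. f (z j) \<partial>B) = 0" using integral_distr[OF m f] d mean by simp
    show "integrable B (\<lambda>z. f (z j))"
      using integrable_distr_eq[OF m f] d D.square_integrable_imp_integrable[OF noise(1)] by simp
  qed
  show "(\<integral>z. minibatch_op Fs \<tau> z y - avg_op Fs y \<partial>B) = 0"
    unfolding eq using comp by simp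
  have "(\<integral>z. (norm (minibatch_op Fs \<tau> z y - avg_op Fs y))\<^sup>2 \<partial>B)
      = 1 / (real \<tau>)\<^sup>2 * (real \<tau> * (\<integral>v. (norm (f v))\<^sup>2 \<partial>D))"
    unfolding eq using S by (simp add: power_divide)
  also have "\<dots> = (\<integral>v. (norm (f v))\<^sup>2 \<partial>D) / real \<tau>" using \<tau> by (simp add: power2_eq_square)
  also have "\<dots> \<le> (\<delta> * (norm (y - xs))\<^sup>2 + 2 * sigma_sq D Fs xs) / real \<tau>"
    by (rule divide_right_mono[OF noise(2)]) simp
  finally show "(\<integral>z. (norm (minibatch_op Fs \<tau> z y - avg_op Fs y))\<^sup>2 \<partial>B)
      \<le> \<delta> / real \<tau> * (norm (y - xs))\<^sup>2 + 2 * sigma_sq D Fs xs / real \<tau>"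
    by (simp add: add_divide_distrib)
qed

section \<open>Independence of a batch from the past\<close>

text \<open>The events decided by the batches of iterations \<open>-1\<close> to \<open>k - 1\<close>, encoded as the initial
  \<open>\<sigma>\<close>-algebra of the family of these samples.\<close>
definition past_algebra ::
  "'w measure \<Rightarrow> nat \<Rightarrow> (int \<Rightarrow> nat \<Rightarrow> 'w \<Rightarrow> real^'n) \<Rightarrow> int \<Rightarrow> 'w measure" where
  "past_algebra M \<tau> v k = vimage_algebra (space M)
     (\<lambda>w. \<lambda>i\<in>{-1..<k} \<times> {1..\<tau>}. v (fst i) (snd i) w) (PiM ({-1..<k} \<times> {1..\<tau>}) (\<lambda>_. borel))"

lemma past_algebra_measurable_sample:
  assumes "- 1 \<le> i" "i < k" "j \<in> {1..\<tau>}"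
  shows "v i j \<in> borel_measurable (past_algebra M \<tau> v k)"
proof -
  have "(\<lambda>w. \<lambda>i\<in>{-1..<k} \<times> {1..\<tau>}. v (fst i) (snd i) w)
      \<in> measurable (past_algebra M \<tau> v k) (PiM ({-1..<k} \<times> {1..\<tau>}) (\<lambda>_. borel))"
    unfolding past_algebra_def by (rule measurable_vimage_algebra1) (auto simp: space_PiM)
  from measurable_compose[OF this measurable_component_singleton[of "(i, j)"]]
  show ?thesis using assms by simp
qed

definition batch :: "nat \<Rightarrow> (int \<Rightarrow> nat \<Rightarrow> 'w \<Rightarrow> real^'n) \<Rightarrow> int \<Rightarrow> 'w \<Rightarrow> nat \<Rightarrow> real^'n" where
  "batch \<tau> v k w = (\<lambda>j\<in>{1..\<tau>}. v k j w)"

lemma iid_samples_batch: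
  fixes v :: "int \<Rightarrow> nat \<Rightarrow> 'w \<Rightarrow> real^'n"
  assumes "prob_space M" and iid: "iid_samples M D \<tau> v" and k: "- 1 \<le> k" and \<tau>: "1 \<le> \<tau>"
    and Y: "Y \<in> measurable (past_algebra M \<tau> v k) S"
  defines "T \<equiv> PiM {1..\<tau>} (\<lambda>_. borel)"
  shows "Y \<in> measurable M S" "batch \<tau> v k \<in> measurable M T"
    and "distr M S Y \<Otimes>\<^sub>M distr M T (batch \<tau> v k) = distr M (S \<Otimes>\<^sub>M T) (\<lambda>w. (Y w, batch \<tau> v k w))"
    and "distr M T (batch \<tau> v k) = PiM {1..\<tau>} (\<lambda>_. D)"
proof -
  interpret prob_space M by fact
  let ?X = "\<lambda>i. v (fst i) (snd i)" and ?A = "{-1..<k} \<times> {1..\<tau>}" and ?I = "{-1..} \<times> {1..\<tau>}"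
  let ?B = "{k} \<times> {1..\<tau>}"
  have ind: "indep_vars (\<lambda>_. borel) ?X ?I" and law: "\<And>j. j \<in> {1..\<tau>} \<Longrightarrow> distr M borel (v k j) = D"
    using iid k by (auto simp: iid_samples_def case_prod_unfold)
  have indep: "indep_var (PiM ?A (\<lambda>_. borel)) (\<lambda>w. restrict (\<lambda>i. ?X i w) ?A)
      (PiM ?B (\<lambda>_. borel)) (\<lambda>w. restrict (\<lambda>i. ?X i w) ?B)"
    using k by (intro indep_var_restrict[OF ind]) auto
  let ?V = "vimage_algebra (space M) (\<lambda>w. restrict (\<lambda>i. ?X i w) ?B) (PiM ?B (\<lambda>_. borel))"
  have "(\<lambda>w. restrict (\<lambda>i. ?X i w) ?B) \<in> measurable ?V (PiM ?B (\<lambda>_. borel))"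
    by (rule measurable_vimage_algebra1) (auto simp: space_PiM)
  moreover have "(\<lambda>u. \<lambda>j\<in>{1..\<tau>}. u (k, j)) \<in> measurable (PiM ?B (\<lambda>_. borel :: (real^'n) measure)) T"
    unfolding T_def by (intro measurable_restrict measurable_component_singleton) auto
  ultimately have "(\<lambda>w. \<lambda>j\<in>{1..\<tau>}. restrict (\<lambda>i. ?X i w) ?B (k, j)) \<in> measurable ?V T"
    by (rule measurable_compose)
  then have Z: "batch \<tau> v k \<in> measurable ?V T"
    by (simp add: batch_def[abs_def] cong: restrict_cong)
  note pair = distr_Pair_indep_var[OF indep Y[unfolded past_algebra_def] Z]
  show "Y \<in> measurable M S" "batch \<tau> v k \<in> measurable M T"
    "distr M S Y \<Otimes>\<^sub>M distr M T (batch \<tau> v k) = distr M (S \<Otimes>\<^sub>M T) (\<lambda>w. (Y w, batch \<tau> v k w))"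
    by (fact pair)+
  have "indep_vars (\<lambda>j. PiM {(k, j)} (\<lambda>_. borel)) (\<lambda>j w. restrict (\<lambda>i. ?X i w) {(k, j)}) {1..\<tau>}"
    using k by (intro indep_vars_restrict[OF ind]) (auto simp: disjoint_family_on_def)
  from indep_vars_compose2[OF this, of "\<lambda>j u. u (k, j)" "\<lambda>_. borel"]
  have "indep_vars (\<lambda>_. borel) (v k) {1..\<tau>}"
    by (simp add: measurable_component_singleton)
  moreover from this have "random_variable borel (v k j)" if "j \<in> {1..\<tau>}" for j
    using that unfolding indep_vars_def by auto
  ultimately have "distr M T (\<lambda>w. \<lambda>j\<in>{1..\<tau>}. v k j w) = PiM {1..\<tau>} (\<lambda>j. distr M borel (v k j))"
    using \<tau> unfolding T_def by (subst indep_vars_iff_distr_eq_PiM'[symmetric]) auto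
  also have "\<dots> = PiM {1..\<tau>} (\<lambda>_. D)" using law by (intro PiM_cong) auto
  finally show "distr M T (batch \<tau> v k) = PiM {1..\<tau>} (\<lambda>_. D)" by (simp add: batch_def[abs_def])
qed

text \<open>The role of conditional expectations given the past: at a point \<open>y\<close> determined by earlier
  batches, the new batch gives noise of controlled size that is orthogonal to everything known
  before it was drawn.\<close>
lemma minibatch_estimator:
  fixes Fs :: "'n::finite \<Rightarrow> real^'d \<Rightarrow> real^'d" and v :: "int \<Rightarrow> nat \<Rightarrow> 'w \<Rightarrow> real^'n"
  assumes "prob_space M" and D: "sampling_distribution D"
    and Fs: "\<And>i. Fs i \<in> borel_measurable borel"
    and zero: "avg_op Fs xs = 0" and er: "expected_residual D Fs \<delta> xs"
    and star: "integrable D (\<lambda>u. (norm (stoch_op Fs u xs))\<^sup>2)" and \<tau>: "1 \<le> \<tau>"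
    and iid: "iid_samples M D \<tau> v" and k: "- 1 \<le> k"
    and y: "y \<in> borel_measurable (past_algebra M \<tau> v k)" "square_integrable M y"
  defines "N \<equiv> \<lambda>w. minibatch_op Fs \<tau> (\<lambda>j. v k j w) (y w) - avg_op Fs (y w)"
  shows "square_integrable M N"
    and "(\<integral>w. (norm (N w))\<^sup>2 \<partial>M)
      \<le> \<delta> / real \<tau> * (\<integral>w. (norm (y w - xs))\<^sup>2 \<partial>M) + 2 * sigma_sq D Fs xs / real \<tau>"
    and "\<And>U. U \<in> borel_measurable (past_algebra M \<tau> v k) \<Longrightarrow> square_integrable M U \<Longrightarrow>
      (\<integral>w. N w \<bullet> U w \<partial>M) = 0"
proof -
  interpret prob_space M by fact
  let ?T = "PiM {1..\<tau>} (\<lambda>_. borel :: (real^'n) measure)" and ?B = "PiM {1..\<tau>} (\<lambda>_. D)"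
  let ?h = "\<lambda>y z. minibatch_op Fs \<tau> z y - avg_op Fs y"
  note estimator = minibatch_op_noise[OF D Fs zero er star \<tau>]
  have N: "N w = ?h (y w) (batch \<tau> v k w)" for w
    unfolding N_def batch_def minibatch_op_restrict ..
  have [measurable]: "avg_op Fs \<in> borel_measurable borel"
    unfolding avg_op_def[abs_def] using Fs by measurable
  have mb: "(\<lambda>p. minibatch_op Fs \<tau> (Z p) (Y p)) \<in> borel_measurable Q"
    if "Z \<in> measurable Q ?T" "Y \<in> borel_measurable Q" for Z Y and Q :: "'q measure"
    using that by (intro minibatch_op_measurable Fs)
      (auto intro: measurable_compose[OF _ measurable_component_singleton])
  have yxs: "square_integrable M (\<lambda>w. y w - xs)"
    by (intro square_integrable_diff square_integrable_const y)
  note pair = iid_samples_batch[OF prob_space_axioms iid k \<tau>]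
  have h: "case_prod ?h \<in> borel_measurable (borel \<Otimes>\<^sub>M ?T)"
    using mb[of snd "borel \<Otimes>\<^sub>M ?T" fst] by (simp add: case_prod_unfold)
  let ?b = "\<lambda>y. \<delta> / real \<tau> * (norm (y - xs))\<^sup>2 + 2 * sigma_sq D Fs xs / real \<tau>"
  have "integrable M (\<lambda>w. ?b (y w))" using yxs by (simp add: square_integrable_def)
  note noise = second_moment_indep_pair[OF pair(1-3)[OF y(1)] h, where b = ?b, unfolded pair(4)[OF y(1)],
      OF square_integrableD(2)[OF estimator(1)] estimator(3) _ this]
  show sqN: "square_integrable M N" unfolding N by (rule noise(1)) measurable
  show "(\<integral>w. (norm (N w))\<^sup>2 \<partial>M)
      \<le> \<delta> / real \<tau> * (\<integral>w. (norm (y w - xs))\<^sup>2 \<partial>M) + 2 * sigma_sq D Fs xs / real \<tau>"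
    using noise(2) yxs unfolding N by (simp add: square_integrable_def prob_space)
  fix U :: "'w \<Rightarrow> real^'d"
  assume U: "U \<in> borel_measurable (past_algebra M \<tau> v k)" "square_integrable M U"
  have "(\<lambda>w. (y w, U w)) \<in> measurable (past_algebra M \<tau> v k) (borel \<Otimes>\<^sub>M borel)"
    using y(1) U(1) by measurable
  note pair2 = pair[OF this]
  let ?h2 = "\<lambda>p z. ?h (fst p) z \<bullet> snd p"
  have h2: "case_prod ?h2 \<in> borel_measurable ((borel \<Otimes>\<^sub>M borel) \<Otimes>\<^sub>M ?T)"
  proof -
    let ?Q = "(borel \<Otimes>\<^sub>M (borel :: (real^'d) measure)) \<Otimes>\<^sub>M ?T"
    have [measurable]: "(\<lambda>q. minibatch_op Fs \<tau> (snd q) (fst (fst q))) \<in> borel_measurable ?Q"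
      by (rule mb) measurable
    have "(\<lambda>q. (minibatch_op Fs \<tau> (snd q) (fst (fst q)) - avg_op Fs (fst (fst q))) \<bullet> snd (fst q))
        \<in> borel_measurable ?Q" by measurable
    then show ?thesis by (simp add: case_prod_unfold)
  qed
  interpret D: prob_space D using D by (simp add: sampling_distribution_def)
  interpret B: prob_space ?B by (intro prob_space_PiM D.prob_space_axioms)
  have "(\<integral>w. N w \<bullet> U w \<partial>M) = (\<integral>w. ?h2 (y w, U w) (batch \<tau> v k w) \<partial>M)"
    by (simp add: N)
  also have "\<dots> = (\<integral>p. \<integral>z. ?h2 p z \<partial>?B \<partial>distr M (borel \<Otimes>\<^sub>M borel) (\<lambda>w. (y w, U w)))"
    unfolding pair2(4)[symmetric]
    by (rule integral_indep_pair[OF pair2(1-3) h2])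
      (use square_integrable_inner[OF sqN U(2)] in \<open>simp add: N\<close>)
  also have "\<dots> = 0"
    using estimator(2) B.square_integrable_imp_integrable[OF estimator(1)] by simp
  finally show "(\<integral>w. N w \<bullet> U w \<partial>M) = 0" .
qed

section \<open>The mini-batched method\<close>

lemma measurable_past_algebra_cong:
  assumes "\<And>w. w \<in> space M \<Longrightarrow> f w = g w" "g \<in> borel_measurable (past_algebra M \<tau> v k)"
  shows "f \<in> borel_measurable (past_algebra M \<tau> v k)"
  using assms measurable_cong[of "past_algebra M \<tau> v k" f g borel] by (simp add: past_algebra_def)

lemma square_integrable_cong:
  assumes "\<And>w. w \<in> space M \<Longrightarrow> f w = g w" "square_integrable M g"
  shows "square_integrable M f"
  using assms by (auto simp: square_integrable_def cong: measurable_cong Bochner_Integration.integrable_cong)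

text \<open>The extrapolated point of iteration \<open>n - 1\<close> depends on the batches before iteration \<open>n - 1\<close>, the iterate
  \<open>x n\<close> on those before iteration \<open>n\<close>. Both are stated for every later \<open>\<sigma>\<close>-algebra as well, so that the
  induction can combine them.\<close>
lemma minibatch_SPEG_measurable:
  fixes Fs :: "'n::finite \<Rightarrow> real^'d \<Rightarrow> real^'d" and v :: "int \<Rightarrow> nat \<Rightarrow> 'w \<Rightarrow> real^'n"
  assumes Fs: "\<And>i. Fs i \<in> borel_measurable borel"
    and speg: "minibatch_SPEG M Fs \<tau> \<gamma>s \<omega>s x0 v x xh"
  shows "(\<forall>k\<ge>int n - 1. xh (int n - 1) \<in> borel_measurable (past_algebra M \<tau> v k)) \<and>
    (\<forall>k\<ge>int n. x (int n) \<in> borel_measurable (past_algebra M \<tau> v k))"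
proof (induction n)
  case 0
  show ?case
    using speg by (auto simp: minibatch_SPEG_def intro: measurable_past_algebra_cong[where g = "\<lambda>_. x0"])
next
  case (Suc n)
  have g: "(\<lambda>w. minibatch_op Fs \<tau> (\<lambda>j. v i j w) (y w)) \<in> borel_measurable (past_algebra M \<tau> v k)"
    if "y \<in> borel_measurable (past_algebra M \<tau> v k)" "- 1 \<le> i" "i < k" for y i k
    using that by (intro minibatch_op_measurable Fs past_algebra_measurable_sample)
  have xh: "xh (int n) \<in> borel_measurable (past_algebra M \<tau> v k)" if "int n \<le> k" for k
  proof (rule measurable_past_algebra_cong)
    show "xh (int n) w = x (int n) w
        - \<gamma>s (int n) *\<^sub>R minibatch_op Fs \<tau> (\<lambda>j. v (int n - 1) j w) (xh (int n - 1) w)"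
      if "w \<in> space M" for w using speg that by (simp add: minibatch_SPEG_def)
    show "(\<lambda>w. x (int n) w
        - \<gamma>s (int n) *\<^sub>R minibatch_op Fs \<tau> (\<lambda>j. v (int n - 1) j w) (xh (int n - 1) w))
        \<in> borel_measurable (past_algebra M \<tau> v k)"
      using Suc.IH that by (intro borel_measurable_diff borel_measurable_scaleR g) auto
  qed
  moreover have "x (int n + 1) \<in> borel_measurable (past_algebra M \<tau> v k)" if "int n + 1 \<le> k" for k
  proof (rule measurable_past_algebra_cong)
    show "x (int n + 1) w = x (int n) w
        - \<omega>s (int n) *\<^sub>R minibatch_op Fs \<tau> (\<lambda>j. v (int n) j w) (xh (int n) w)"
      if "w \<in> space M" for w using speg that by (simp add: minibatch_SPEG_def)
    show "(\<lambda>w. x (int n) w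
        - \<omega>s (int n) *\<^sub>R minibatch_op Fs \<tau> (\<lambda>j. v (int n) j w) (xh (int n) w))
        \<in> borel_measurable (past_algebra M \<tau> v k)"
      using Suc.IH xh[of k] that by (intro borel_measurable_diff borel_measurable_scaleR g) auto
  qed
  ultimately show ?case by (simp add: add.commute)
qed

theorem theorem2p4:
  fixes Fs :: "'n::finite \<Rightarrow> real^'d \<Rightarrow> real^'d"
    and D :: "(real^'n) measure"
    and M :: "'w measure"
    and v :: "int \<Rightarrow> nat \<Rightarrow> 'w \<Rightarrow> real^'n"
    and x xh :: "int \<Rightarrow> 'w \<Rightarrow> real^'d"
    and \<gamma>s \<omega>s :: "int \<Rightarrow> real"
    and xs x0 :: "real^'d"
    and L \<rho> \<delta> \<gamma> \<omega> C :: real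
    and \<tau> K :: nat
  assumes "sampling_distribution D"
    and "\<And>i. Fs i \<in> borel_measurable borel"
    and "L > 0"
    and "L-lipschitz_on UNIV (avg_op Fs)"
    and "avg_op Fs xs = 0"
    and "0 \<le> \<rho>" and "\<rho> < 1 / (2 * L)"
    and "weak_minty (avg_op Fs) \<rho> xs"
    and "\<delta> > 0"
    and "expected_residual D Fs \<delta> xs"
    and "integrable D (\<lambda>u. (norm (stoch_op Fs u xs))\<^sup>2)"
    and "max (2 * \<rho>) (1 / (2 * L)) < \<gamma>" and "\<gamma> < 1 / L"
    and "0 < \<omega>" and "\<omega> < min (\<gamma> - 2 * \<rho>) (1 / (4 * L) - \<gamma> / 4)"
    and "\<And>k. k \<ge> 0 \<Longrightarrow> \<gamma>s k = \<gamma>" and "\<And>k. k \<ge> 0 \<Longrightarrow> \<omega>s k = \<omega>"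
    and "x0 \<noteq> xs"
    and "K \<ge> 2"
    and "real \<tau> \<ge> Max {1,
            32 * \<delta> / ((1 - L * \<gamma>) * L ^ 3 * \<omega>),
            48 * \<omega> * \<gamma> * \<delta> * (real K - 1) / (1 - L * \<gamma>)\<^sup>2,
            2 * \<omega> * \<gamma> * sigma_sq D Fs xs * (real K - 1) / ((1 - L * \<gamma>) * (norm (x0 - xs))\<^sup>2)}"
    and "prob_space M"
    and "iid_samples M D \<tau> v"
    and "minibatch_SPEG M Fs \<tau> \<gamma>s \<omega>s x0 v x xh"
    and "C = 48 / (\<omega> * \<gamma> * (1 - L * (\<gamma> + 4 * \<omega>)))"
  shows "(\<forall>k\<in>{0..int K - 1}. integrable M (\<lambda>w. (norm (avg_op Fs (xh k w)))\<^sup>2)) \<and>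
    (MIN k\<in>{0..int K - 1}. (\<integral>w. (norm (avg_op Fs (xh k w)))\<^sup>2 \<partial>M))
      \<le> C * (norm (x0 - xs))\<^sup>2 / (real K - 1)"
proof -
  note D = assms(1) and Fs = assms(2) and L = assms(3) and lip = assms(4) and zero = assms(5)
    and er = assms(10) and star = assms(11) and iid = assms(22) and speg = assms(23)
  interpret prob_space M by fact
  define a where "a = 1 - L * \<gamma>"
  define R where "R = (norm (x0 - xs))\<^sup>2"
  define m where "m = K - 1"
  define d where "d = \<delta> / real \<tau>"
  define s where "s = 2 * sigma_sq D Fs xs / real \<tau>"
  have \<gamma>: "1 / (2 * L) < \<gamma>" "2 * \<rho> < \<gamma>" and \<omega>: "\<omega> < \<gamma> - 2 * \<rho>" "\<omega> < 1 / (4 * L) - \<gamma> / 4"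
    using assms(12,15) by auto
  have \<gamma>0: "0 < \<gamma>" using \<gamma>(1) L by (rule_tac order_less_trans[of 0 "1 / (2 * L)"]) auto
  have \<omega>0: "0 < \<omega>" by fact
  have a: "0 < a" "a < 1" using assms(13) L \<gamma>0 by (auto simp: a_def field_simps)
  have L\<omega>: "4 * (L * \<omega>) < a" using \<omega>(2) L by (simp add: a_def field_simps)
  have R: "0 < R" using assms(18) by (simp add: R_def)
  have m: "real m = real K - 1" "1 \<le> m" using assms(19) by (auto simp: m_def)
  have \<tau>: "1 \<le> real \<tau>" "32 * \<delta> / (a * L ^ 3 * \<omega>) \<le> real \<tau>"
    "48 * \<omega> * \<gamma> * \<delta> * real m / a\<^sup>2 \<le> real \<tau>"
    "2 * \<omega> * \<gamma> * sigma_sq D Fs xs * real m / (a * R) \<le> real \<tau>"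
    using assms(20) by (auto simp: a_def R_def m)
  then have \<tau>1: "1 \<le> \<tau>" by simp
  have d0: "0 \<le> d" using assms(9) by (simp add: d_def)
  have s0: "0 \<le> s" by (auto simp: s_def sigma_sq_def)
  have d1: "d * \<gamma>\<^sup>2 \<le> a\<^sup>2 / 128"
  proof -
    have "32 * \<delta> \<le> real \<tau> * (a * L ^ 3 * \<omega>)"
      using \<tau>(2) a L \<omega>0 by (simp add: pos_divide_le_eq)
    then have "d \<le> a * L ^ 3 * \<omega> / 32" using \<tau>(1) by (simp add: d_def field_simps)
    then have "d * \<gamma>\<^sup>2 \<le> a * L ^ 3 * \<omega> / 32 * \<gamma>\<^sup>2" by (rule mult_right_mono) simp
    also have "\<dots> = a / 32 * (L * \<omega>) * (L * \<gamma>)\<^sup>2" by (simp add: power3_eq_cube power2_eq_square)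
    also have "\<dots> \<le> a / 32 * (a / 4) * 1"
      using a L\<omega> L \<omega>0 \<gamma>0 by (intro mult_mono power_le_one) (auto simp: a_def)
    also have "\<dots> = a\<^sup>2 / 128" by (simp add: power2_eq_square)
    finally show ?thesis .
  qed
  have d2: "\<omega> * \<gamma> * d * real m \<le> a\<^sup>2 / 48"
    using \<tau>(1,3) a by (simp add: d_def field_simps)
  have s1: "\<omega> * \<gamma> * s * real m \<le> a * R"
    using \<tau>(1,4) a R by (simp add: s_def field_simps)
  \<comment> \<open>The shift turns iteration \<open>-1\<close> of the method into index \<open>0\<close>: \<open>y 0 = xh (-1)\<close> and
    \<open>g 0\<close> uses the batch with index \<open>-1\<close>.\<close>
  define X where "X n = x (int n)" for n
  define y where "y n = xh (int n - 1)" for n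
  define g where "g n w = minibatch_op Fs \<tau> (\<lambda>j. v (int n - 1) j w) (y n w)" for n w
  have init: "X 0 w = x0" "y 0 w = x0" if "w \<in> space M" for w
    using speg that by (simp_all add: minibatch_SPEG_def X_def y_def)
  have extrapolate: "y (Suc n) w = X n w - \<gamma> *\<^sub>R g n w"
    and update: "X (Suc n) w = X n w - \<omega> *\<^sub>R g (Suc n) w" if "w \<in> space M" for n w
  proof -
    have "xh (int n) w = x (int n) w
        - \<gamma>s (int n) *\<^sub>R minibatch_op Fs \<tau> (\<lambda>j. v (int n - 1) j w) (xh (int n - 1) w)"
      "x (int n + 1) w = x (int n) w
        - \<omega>s (int n) *\<^sub>R minibatch_op Fs \<tau> (\<lambda>j. v (int n) j w) (xh (int n) w)"
      using speg that unfolding minibatch_SPEG_def by (meson of_nat_0_le_iff)+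
    then show "y (Suc n) w = X n w - \<gamma> *\<^sub>R g n w" "X (Suc n) w = X n w - \<omega> *\<^sub>R g (Suc n) w"
      using assms(16)[of "int n"] assms(17)[of "int n"]
      unfolding X_def y_def g_def by (simp_all only: of_nat_Suc add.commute[of 1] add_diff_cancel_right' of_nat_0_le_iff)
  qed
  note meas = minibatch_SPEG_measurable[OF Fs speg]
  have ym: "y n \<in> borel_measurable (past_algebra M \<tau> v (int n - 1))" for n
    using meas[of n] by (simp add: y_def)
  have Xm: "X n \<in> borel_measurable (past_algebra M \<tau> v (int (Suc n) - 1))" for n
    using meas[of n] by (simp add: X_def)
  note estimator = minibatch_estimator[OF prob_space_axioms D Fs zero er star \<tau>1 iid _ ym, folded g_def]
  have sqg_if: "square_integrable M (g n)" if "square_integrable M (y n)" for n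
    using square_integrable_add[OF estimator(1)[OF _ that]
        square_integrable_Lipschitz[OF finite_measure_axioms that lip]] by simp
  have sq: "square_integrable M (X n) \<and> square_integrable M (y n)" for n
  proof (induction n)
    case 0
    then show ?case
      using init by (auto intro: square_integrable_cong[OF _ square_integrable_const[of x0]])
  next
    case (Suc n)
    have "square_integrable M (\<lambda>w. X n w - \<gamma> *\<^sub>R g n w)"
      using Suc by (intro square_integrable_diff square_integrable_scaleR sqg_if) auto
    then have y: "square_integrable M (y (Suc n))"
      by (rule square_integrable_cong[rotated]) (rule extrapolate)
    have "square_integrable M (\<lambda>w. X n w - \<omega> *\<^sub>R g (Suc n) w)"
      using Suc y by (intro square_integrable_diff square_integrable_scaleR sqg_if) auto
    then have "square_integrable M (X (Suc n))"
      by (rule square_integrable_cong[rotated]) (rule update)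
    with y show ?case by simp
  qed
  then have sqX: "square_integrable M (X n)" and sqy: "square_integrable M (y n)"
    and sqg: "square_integrable M (g n)"
    and sqF: "square_integrable M (\<lambda>w. avg_op Fs (y n w))" for n
    by (auto intro: sqg_if square_integrable_Lipschitz[OF finite_measure_axioms _ lip])
  have [measurable]: "avg_op Fs \<in> borel_measurable borel"
    unfolding avg_op_def[abs_def] using Fs by measurable
  have bound: "\<omega> * \<gamma> * (\<Sum>n\<le>m. \<integral>w. (norm (avg_op Fs (y n w)))\<^sup>2 \<partial>M) \<le> 24 * R / a"
    unfolding R_def a_def
  proof (rule past_extragradient_energy_bound[where X = X and y = y and g = g and F = "avg_op Fs"
        and xs = xs and \<rho> = \<rho> and d = d and s = s])
    show "(\<integral>w. (g n w - avg_op Fs (y n w)) \<bullet> avg_op Fs (y n w) \<partial>M) = 0" for n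
      using ym[of n] by (intro estimator(3) sqy sqF) auto
    show "(\<integral>w. (g (Suc n) w - avg_op Fs (y (Suc n) w)) \<bullet> (X n w - xs) \<partial>M) = 0" for n
      using Xm[of n] by (intro estimator(3) sqy square_integrable_diff sqX square_integrable_const) auto
    show "(\<integral>w. (norm (g n w - avg_op Fs (y n w)))\<^sup>2 \<partial>M)
        \<le> d * (\<integral>w. (norm (y n w - xs))\<^sup>2 \<partial>M) + s" for n
      unfolding d_def s_def by (rule estimator(2)) (simp_all add: sqy)
    show "- \<rho> * (norm (avg_op Fs x))\<^sup>2 \<le> avg_op Fs x \<bullet> (x - xs)" for x
      using assms(8) by (simp add: weak_minty_def)
    show "\<omega> * \<gamma> * d * real m \<le> (1 - L * \<gamma>)\<^sup>2 / 48" "d * \<gamma>\<^sup>2 \<le> (1 - L * \<gamma>)\<^sup>2 / 128"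
      "\<omega> * \<gamma> * s * real m \<le> (1 - L * \<gamma>) * (norm (x0 - xs))\<^sup>2"
      using d1 d2 s1 by (simp_all add: a_def R_def)
  qed (use prob_space_axioms L lip zero \<gamma> \<omega> \<omega>0 assms(13) init extrapolate update sqX sqy sqg d0 s0 m
      in \<open>auto simp: less_imp_le\<close>)
  define P where "P k = (\<integral>w. (norm (avg_op Fs (xh k w)))\<^sup>2 \<partial>M)" for k
  \<comment> \<open>The energy bound covers \<open>xh (-1), \<dots>, xh (K - 2)\<close>. Dropping the artificial index \<open>-1\<close> leaves
    \<open>K - 1\<close> terms, which is where the denominator of the rate comes from.\<close>
  define \<mu> where "\<mu> = (MIN k\<in>{0..int K - 1}. P k)"
  have "real m * \<mu> \<le> (\<Sum>n<m. P (int n))"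
  proof -
    have "\<mu> \<le> P (int n)" if "n < m" for n
      unfolding \<mu>_def using that by (intro Min_le) (auto simp: m_def)
    then show ?thesis using sum_bounded_below[of "{..<m}" \<mu> "\<lambda>n. P (int n)"] by simp
  qed
  also have "\<dots> \<le> (\<Sum>n\<le>m. P (int n - 1))"
    unfolding sum.atMost_shift by (simp add: P_def)
  finally have "\<omega> * \<gamma> * (real m * \<mu>) \<le> \<omega> * \<gamma> * (\<Sum>n\<le>m. P (int n - 1))"
    using \<omega>0 \<gamma>0 by (intro mult_left_mono) auto
  also have "\<dots> \<le> 24 * R / a" using bound by (simp add: P_def y_def)
  also have "\<dots> \<le> 48 * R / (a - 4 * (L * \<omega>))"
    using R a L\<omega> L \<omega>0 by (intro frac_le) auto
  finally have "\<mu> \<le> 48 * R / (a - 4 * (L * \<omega>)) / (\<omega> * \<gamma> * real m)"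
    using \<omega>0 \<gamma>0 m by (subst pos_le_divide_eq) (auto simp: mult_ac)
  also have "\<dots> = C * R / (real K - 1)"
    unfolding assms(24) m(1)[symmetric] by (simp add: a_def algebra_simps)
  finally have "\<mu> \<le> C * R / (real K - 1)" .
  moreover have "integrable M (\<lambda>w. (norm (avg_op Fs (xh k w)))\<^sup>2)" if "k \<in> {0..int K - 1}" for k
    using square_integrableD(2)[OF sqF[of "Suc (nat k)"]] that by (simp add: y_def)
  ultimately show ?thesis by (simp add: \<mu>_def P_def R_def)
qed

end
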